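(* Let $d \geq 1$ be an integer and fix some $l \in \{1, \ldots, d\}$. Let $X_0, \ldots, X_l$ be independent $d$-dimensional standard Gaussian vectors. Then for any $\sigma_0, \ldots, \sigma_l > 0$, $$|\mathrm{conv}(\sigma_0X_0, \ldots, \sigma_lX_l)| \stackrel{d}{=} \frac{1}{l!}\,\sigma_0\cdots\sigma_l\,\sqrt{\frac{1}{\sigma_0^2} + \cdots + \frac{1}{\sigma_l^2}}\;\chi_{d - l + 1}\cdots\chi_d,$$ where $\chi_{d-l+1}, \ldots, \chi_d$ are independent random variables such that for any $k = d - l + 1, \ldots, d$ the random variable $\chi_k$ has the chi distribution with $k$ degrees of freedom.
   Context: A standard Gaussian vector in $\mathbb{R}^d$ is a random vector with independent $N(0,1)$ coordinates. $\mathrm{conv}(x_0,\ldots,x_l)$ denotes the convex hull of the points $x_0,\ldots,x_l\in\mathbb{R}^d$, and $|\cdot|$ denotes the $l$-dimensional volume. The chi distribution with $k$ degrees of freedom is the distribution of the Euclidean norm of a standard Gaussian vector in $\mathbb{R}^k$. The symbol $\stackrel{d}{=}$ denotes equality in distribution. *)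

theory Defs
  imports "HOL-Probability.Probability"
begin

definition std_gaussian_vector :: "'w measure \<Rightarrow> ('w \<Rightarrow> real ^ 'd) \<Rightarrow> bool" where
  "std_gaussian_vector M X \<longleftrightarrow>
     prob_space.indep_vars M (\<lambda>_. borel) (\<lambda>j \<omega>. X \<omega> $ j) (UNIV :: 'd set) \<and>
     (\<forall>j. distributed M lborel (\<lambda>\<omega>. X \<omega> $ j) std_normal_density)"

text \<open>Here the standard Gaussian vector in dimension k is the identity on the k-fold product of
  N(0,1), because k is not tied to a type; \<^const>\<open>L2_set\<close> is its Euclidean norm.\<close>

definition chi_distribution :: "nat \<Rightarrow> real measure" where
  "chi_distribution k =
     distr (Pi\<^sub>M {..<k} (\<lambda>_. density lborel std_normal_density)) borel (\<lambda>x. L2_set x {..<k})"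

definition orthonormal_frame :: "nat \<Rightarrow> (nat \<Rightarrow> 'a::euclidean_space) \<Rightarrow> bool" where
  "orthonormal_frame l e \<longleftrightarrow> (\<forall>i<l. \<forall>j<l. e i \<bullet> e j = (if i = j then 1 else 0))"

definition flat_point :: "nat \<Rightarrow> 'a::euclidean_space \<Rightarrow> (nat \<Rightarrow> 'a) \<Rightarrow> (nat \<Rightarrow> real) \<Rightarrow> 'a" where
  "flat_point l p e t = p + (\<Sum>i<l. t i *\<^sub>R e i)"

text \<open>The l-dimensional volume of a bounded Borel set S contained in an l-dimensional affine subspace:
  the l-dimensional Lebesgue measure of S in Cartesian coordinates (origin p, orthonormal
  directions e) of such a subspace. The value does not depend on the coordinates. If S lies in
  two different such subspaces, it lies in a subspace of smaller dimension and the value is 0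
  in both. Nothing is claimed for sets not contained in an l-dimensional affine subspace.\<close>

definition volume_dim :: "nat \<Rightarrow> 'a::euclidean_space set \<Rightarrow> real" where
  "volume_dim l S =
     (THE v. \<exists>p e. orthonormal_frame l e \<and> S \<subseteq> range (flat_point l p e) \<and>
        v = measure (Pi\<^sub>M {..<l} (\<lambda>_. lborel))
              {t \<in> space (Pi\<^sub>M {..<l} (\<lambda>_. lborel)). flat_point l p e t \<in> S})"

text \<open>Measurability is required explicitly, since \<^const>\<open>distr\<close> is not meaningful
  for non-measurable functions.\<close>

definition eq_in_distribution ::
  "'w measure \<Rightarrow> ('w \<Rightarrow> real) \<Rightarrow> 'v measure \<Rightarrow> ('v \<Rightarrow> real) \<Rightarrow> bool" where
  "eq_in_distribution M Y N Z \<longleftrightarrow>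
     Y \<in> borel_measurable M \<and> Z \<in> borel_measurable N \<and> distr M borel Y = distr N borel Z"

end

theory Submission
  imports Defs
begin

text \<open>The volume of the simplex is \<open>1 / l!\<close> times the product of the Gram-Schmidt heights of its edge
  vectors \<open>v k = \<sigma> (k+1) X (k+1) - \<sigma> 0 X 0\<close>. These edges are correlated, but successive plane
  rotations among \<open>X 0, \<dots>, X l\<close>, each mixing the normalized running sum of \<open>X j / \<sigma> j\<close> with the next
  vector, produce independent standard Gaussian vectors \<open>Z k\<close> such that \<open>v k\<close> is a constant multiple
  of \<open>Z k\<close> modulo the earlier edges. Hence the heights of \<open>v\<close> are those of \<open>Z\<close> times constants whose
  product telescopes, and the heights of \<open>Z\<close> are independent with chi distributions: given
  the first \<open>k\<close> vectors, the next height is the norm of the projection of a Gaussian vector onto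
  a subspace of dimension \<open>d - k\<close>.\<close>

subsection \<open>Rotation invariance of Lebesgue and Gaussian measure\<close>

text \<open>The sum of the \<open>X j / \<sigma> j\<close> is uncorrelated with every edge:
  coordinatewise its covariance with \<open>\<sigma> i X i - \<sigma> 0 X 0\<close> is
  \<open>1 - 1 = 0\<close>. After a rotation that makes the normalized sum one of the l + 1 Gaussian
  vectors, the edges involve only the other l. With \<open>s k\<close> the sum of
  \<open>1 / (\<sigma> j)^2\<close> over \<open>j \<le> k\<close>, the constant attached to
  \<open>Z k\<close> is \<open>\<sigma> (k+1) * sqrt (s (k+1) / s k)\<close>. Its square is
  \<open>(\<sigma> (k+1))^2 + 1 / s k\<close>: the variance of the new point plus that of the
  inverse-variance weighted mean of its predecessors. Rotating two vectors at a time keeps the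
  invariance argument inside \<open>'a \<times> 'a\<close>, where a pair of independent Gaussian
  vectors is a single one.

  The volume side is shaped by the definite description in \<open>volume_dim\<close>: all admissible
  frames must give the same value, and this for every outcome rather than almost surely, since the
  left-hand side has to be measurable as it stands. Hence degenerate simplices are treated as well;
  there some residual, and with it the product of heights, is 0.\<close>

lemma borel_measurable_orthogonal_transformation:
  fixes T :: "'a::euclidean_space \<Rightarrow> 'a"
  assumes "orthogonal_transformation T"
  shows "T \<in> borel_measurable borel"
  using assms by (intro borel_measurable_continuous_onI linear_continuous_on)
    (simp add: linear_linear orthogonal_transformation_linear)

lemma nn_integral_lborel_translate:
  fixes f :: "'a::euclidean_space \<Rightarrow> ennreal"
  assumes [measurable]: "f \<in> borel_measurable borel"
  shows "(\<integral>\<^sup>+x. f (x + a) \<partial>lborel) = (\<integral>\<^sup>+x. f x \<partial>lborel)"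
proof -
  have "(\<integral>\<^sup>+x. f x \<partial>lborel) = (\<integral>\<^sup>+x. f x \<partial>distr lborel borel ((+) a))"
    by (simp add: lborel_distr_plus)
  also have "\<dots> = (\<integral>\<^sup>+x. f (x + a) \<partial>lborel)"
    by (subst nn_integral_distr) (simp_all add: add.commute)
  finally show ?thesis by simp
qed

text \<open>The usual uniqueness argument for Haar measure: with \<open>\<mu>\<close> the image measure and \<open>B\<close> the unit
  ball, evaluate the double integral of the indicator of \<open>x + y \<in> A, y \<in> B\<close> in both orders.\<close>

lemma distr_lborel_orthogonal:
  fixes T :: "'a::euclidean_space \<Rightarrow> 'a"
  assumes T: "orthogonal_transformation T"
  shows "distr lborel borel T = lborel"
proof (rule measure_eqI)
  note [measurable] = borel_measurable_orthogonal_transformation[OF T]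
  define \<mu> where "\<mu> = distr lborel borel T"
  have sets_\<mu>[measurable_cong]: "sets \<mu> = sets borel" by (simp add: \<mu>_def)
  have lin: "linear T" by (rule orthogonal_transformation_linear[OF T])
  obtain T' where T': "\<And>x. T (T' x) = x" 
    using orthogonal_transformation_surj[OF T] by (metis surj_def)
  have int_\<mu>: "(\<integral>\<^sup>+x. f x \<partial>\<mu>) = (\<integral>\<^sup>+x. f (T x) \<partial>lborel)" if "f \<in> borel_measurable borel" for f
    using that unfolding \<mu>_def by (subst nn_integral_distr) auto
  have trans: "(\<integral>\<^sup>+x. f (x + a) \<partial>\<mu>) = (\<integral>\<^sup>+x. f x \<partial>\<mu>)"
    if [measurable]: "f \<in> borel_measurable borel" for f a
  proof -
    have "(\<integral>\<^sup>+x. f (x + a) \<partial>\<mu>) = (\<integral>\<^sup>+x. f (T (x + T' a)) \<partial>lborel)"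
      using lin by (subst int_\<mu>) (auto simp: linear_add T')
    also have "\<dots> = (\<integral>\<^sup>+x. f (T x) \<partial>lborel)"
      by (rule nn_integral_lborel_translate) measurable
    finally show ?thesis by (simp add: int_\<mu>)
  qed
  \<comment> \<open>\<open>T\<close> preserves norms, so the unit ball has equal mass under
    \<open>\<mu>\<close> and \<open>lborel\<close>. This fixes the constant in the uniqueness
    argument as 1.\<close>
  have vim: "T -` ball 0 1 = ball 0 1"
    using T by (auto simp: orthogonal_transformation_norm)
  have \<mu>B: "emeasure \<mu> (ball 0 1) = emeasure lborel (ball 0 1 :: 'a set)"
    by (simp add: \<mu>_def emeasure_distr vim)
  interpret \<mu>: sigma_finite_measure \<mu>
  proof
    let ?C = "range (\<lambda>n. ball (0::'a) (real n))"
    have "(\<Union>a\<in>?C. a) = (UNIV :: 'a set)"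
      by (auto simp: dist_norm) (metis reals_Archimedean2)
    moreover have "T -` ball 0 r = ball 0 r" for r
      using T by (auto simp: orthogonal_transformation_norm)
    moreover have "emeasure lborel (ball (0::'a) r) \<noteq> \<top>" for r
      using emeasure_lborel_ball_finite[of "0::'a" r] by auto
    ultimately show "\<exists>A. countable A \<and> A \<subseteq> sets \<mu> \<and> \<Union>A = space \<mu> \<and> (\<forall>a\<in>A. emeasure \<mu> a \<noteq> \<infinity>)"
      by (intro exI[of _ ?C])
        (auto simp: \<mu>_def emeasure_distr)
  qed
  interpret pair_sigma_finite \<mu> "lborel :: 'a measure" ..
  fix A assume "A \<in> sets (distr lborel borel T)"
  then have [measurable]: "A \<in> sets borel" by simp
  define B where "B = ball (0::'a) 1"
  have [measurable]: "B \<in> sets borel" by (simp add: B_def)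
  have "emeasure \<mu> A * emeasure lborel B = (\<integral>\<^sup>+y. (\<integral>\<^sup>+x. indicator A x \<partial>\<mu>) * indicator B y \<partial>lborel)"
    by (simp add: nn_integral_cmult_indicator \<mu>_def)
  also have "\<dots> = (\<integral>\<^sup>+y. (\<integral>\<^sup>+x. indicator A (x + y) * indicator B y \<partial>\<mu>) \<partial>lborel)"
    by (subst nn_integral_multc) (auto simp: trans[of "indicator A"])
  also have "\<dots> = (\<integral>\<^sup>+x. (\<integral>\<^sup>+y. indicator A (x + y) * indicator B y \<partial>lborel) \<partial>\<mu>)"
    by (rule Fubini') measurable
  also have "\<dots> = (\<integral>\<^sup>+x. (\<integral>\<^sup>+y. indicator A y * indicator B (y - x) \<partial>lborel) \<partial>\<mu>)"
  proof (rule nn_integral_cong)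
    fix x
    show "(\<integral>\<^sup>+y. indicator A (x + y) * indicator B y \<partial>lborel) = (\<integral>\<^sup>+y. indicator A y * indicator B (y - x) \<partial>lborel)"
      using nn_integral_lborel_translate[of "\<lambda>y. indicator A y * indicator B (y - x)" x]
      by (simp add: add.commute)
  qed
  also have "\<dots> = (\<integral>\<^sup>+y. (\<integral>\<^sup>+x. indicator A y * indicator B (y - x) \<partial>\<mu>) \<partial>lborel)"
    by (rule Fubini'[symmetric]) measurable
  also have "\<dots> = (\<integral>\<^sup>+y. indicator A y * emeasure \<mu> B \<partial>lborel)"
  proof (intro nn_integral_cong)
    fix y :: 'a
    \<comment> \<open>The ball is symmetric about 0, so \<open>y - x\<close> may be replaced by
      \<open>x - y\<close>, to which translation invariance of \<open>\<mu>\<close> applies.\<close>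
    have "(\<integral>\<^sup>+x. indicator B (y - x) \<partial>\<mu>) = (\<integral>\<^sup>+x. indicator B (x + - y) \<partial>\<mu>)"
      by (intro nn_integral_cong) (auto simp: indicator_def B_def dist_norm norm_minus_commute)
    also have "\<dots> = emeasure \<mu> B"
      by (subst trans) (auto simp: \<mu>_def)
    finally show "(\<integral>\<^sup>+x. indicator A y * indicator B (y - x) \<partial>\<mu>) = indicator A y * emeasure \<mu> B"
      by (subst nn_integral_cmult) auto
  qed
  also have "\<dots> = emeasure lborel A * emeasure lborel B"
    by (simp add: nn_integral_multc \<mu>B[folded B_def])
  finally have "emeasure \<mu> A * emeasure lborel B = emeasure lborel A * emeasure lborel B" .
  moreover have "emeasure lborel B \<noteq> 0"
    using emeasure_lborel_ball_finite[of "0::'a" 1] content_ball_pos[of 1 "0::'a"]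
    by (auto simp: measure_def B_def)
  moreover have "emeasure lborel B \<noteq> \<top>"
    using emeasure_lborel_ball_finite[of "0::'a" 1] by (auto simp: B_def)
  ultimately have "emeasure \<mu> A = emeasure lborel A"
    by (metis ennreal_mult_divide_eq)
  then show "emeasure (distr lborel borel T) A = emeasure lborel A" by (simp add: \<mu>_def)
qed simp

text \<open>The inverse image of a box is the box with its sides relabelled along \<open>h\<close>.
  It is stated for sigma-finite factors because it will move Lebesgue measure from the index set
  \<open>Basis\<close> to another one of the same size.\<close>

lemma distr_PiM_bij_betw:
  assumes "sigma_finite_measure N" and I: "finite I" and h: "bij_betw h I J"
  shows "distr (Pi\<^sub>M J (\<lambda>_. N)) (Pi\<^sub>M I (\<lambda>_. N)) (\<lambda>x. \<lambda>i\<in>I. x (h i)) = Pi\<^sub>M I (\<lambda>_. N)"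
proof -
  interpret sigma_finite_measure N by fact
  interpret product_sigma_finite "\<lambda>_. N" by standard
  have J: "finite J" using h I bij_betw_finite by blast
  have hJ: "h i \<in> J" if "i \<in> I" for i using h that by (auto simp: bij_betw_def)
  have [measurable]: "(\<lambda>x. \<lambda>i\<in>I. x (h i)) \<in> Pi\<^sub>M J (\<lambda>_. N) \<rightarrow>\<^sub>M Pi\<^sub>M I (\<lambda>_. N)"
    by (rule measurable_restrict) (auto intro: measurable_component_singleton hJ)
  show ?thesis
  proof (rule PiM_eqI)
    fix A assume A: "\<And>i. i \<in> I \<Longrightarrow> A i \<in> sets N"
    define B where "B j = A (inv_into I h j)" for j
    have Bh: "B (h i) = A i" if "i \<in> I" for i
      using that h by (simp add: B_def bij_betw_def)
    have B: "B j \<in> sets N" if "j \<in> J" for j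
      using that h A by (auto simp: B_def bij_betw_def inv_into_into)
    have J_eq: "J = h ` I" using h by (auto simp: bij_betw_def)
    have "(\<lambda>x. \<lambda>i\<in>I. x (h i)) -` (Pi\<^sub>E I A) \<inter> space (Pi\<^sub>M J (\<lambda>_. N)) = Pi\<^sub>E J B"
      using A[THEN sets.sets_into_space] Bh hJ
      by (auto simp: space_PiM PiE_iff J_eq) blast
    moreover have "Pi\<^sub>E I A \<in> sets (Pi\<^sub>M I (\<lambda>_. N))" using A I by (intro sets_PiM_I_finite) auto
    ultimately have "emeasure (distr (Pi\<^sub>M J (\<lambda>_. N)) (Pi\<^sub>M I (\<lambda>_. N)) (\<lambda>x. \<lambda>i\<in>I. x (h i))) (Pi\<^sub>E I A)
        = emeasure (Pi\<^sub>M J (\<lambda>_. N)) (Pi\<^sub>E J B)"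
      by (subst emeasure_distr) auto
    also have "\<dots> = (\<Prod>j\<in>J. emeasure N (B j))"
      using B J by (subst emeasure_PiM) auto
    also have "\<dots> = (\<Prod>i\<in>I. emeasure N (A i))"
      using prod.reindex_bij_betw[OF h, of "\<lambda>j. emeasure N (B j)"] by (simp add: Bh)
    finally show "emeasure (distr (Pi\<^sub>M J (\<lambda>_. N)) (Pi\<^sub>M I (\<lambda>_. N)) (\<lambda>x. \<lambda>i\<in>I. x (h i))) (Pi\<^sub>E I A)
        = (\<Prod>i\<in>I. emeasure N (A i))" .
  qed (use I in simp_all)
qed

lemma inner_orthonormal_sum:
  assumes "finite I" and "\<And>i j. i \<in> I \<Longrightarrow> j \<in> I \<Longrightarrow> e i \<bullet> e j = (if i = j then 1 else 0)"
  shows "(\<Sum>i\<in>I. a i *\<^sub>R e i) \<bullet> (\<Sum>i\<in>I. b i *\<^sub>R e i) = (\<Sum>i\<in>I. a i * b i)"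
proof -
  have "(\<Sum>i\<in>I. a i *\<^sub>R e i) \<bullet> (\<Sum>i\<in>I. b i *\<^sub>R e i) = (\<Sum>i\<in>I. \<Sum>j\<in>I. a i * (b j * (e i \<bullet> e j)))"
    unfolding inner_sum_left unfolding inner_sum_right by (simp add: mult.left_commute)
  also have "\<dots> = (\<Sum>i\<in>I. \<Sum>j\<in>I. if i = j then a i * b i else 0)"
    using assms(2) by (intro sum.cong) auto
  also have "\<dots> = (\<Sum>i\<in>I. a i * b i)"
    using assms(1) by simp
  finally show ?thesis .
qed

lemma measurable_sum_coordinates[measurable]:
  fixes e :: "'i \<Rightarrow> 'a::euclidean_space"
  assumes "\<And>i. i \<in> I \<Longrightarrow> sets (N i) = sets borel"
  shows "(\<lambda>t. \<Sum>i\<in>I. t i *\<^sub>R e i) \<in> borel_measurable (Pi\<^sub>M I N)"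
proof (intro borel_measurable_sum borel_measurable_scaleR)
  fix i assume "i \<in> I"
  then show "(\<lambda>t. t i) \<in> borel_measurable (Pi\<^sub>M I N)"
    using measurable_component_singleton[of i I N] assms[of i] measurable_cong_sets by blast
qed auto

text \<open>For the coordinates along \<open>Basis\<close> this is \<open>lborel_eq\<close>. The map
  \<open>T\<close> in the proof sends \<open>h i\<close> to \<open>e i\<close>, so it is orthogonal,
  and invariance of Lebesgue measure under \<open>T\<close> replaces \<open>Basis\<close> by any
  orthonormal basis.\<close>

lemma distr_lborel_coordinates:
  fixes e :: "'i \<Rightarrow> 'a::euclidean_space"
  assumes I: "finite I" "card I = DIM('a)"
    and e: "\<And>i j. i \<in> I \<Longrightarrow> j \<in> I \<Longrightarrow> e i \<bullet> e j = (if i = j then 1 else 0)"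
  shows "distr (Pi\<^sub>M I (\<lambda>_. lborel)) borel (\<lambda>t. \<Sum>i\<in>I. t i *\<^sub>R e i) = lborel"
proof -
  obtain h where h: "bij_betw h I (Basis :: 'a set)"
    using I finite_same_card_bij[of I "Basis :: 'a set"] by auto
  define T where "T x = (\<Sum>i\<in>I. (x \<bullet> h i) *\<^sub>R e i)" for x
  have "linear T"
    by (rule linearI) (simp_all add: T_def inner_add_left scaleR_add_left sum.distrib scaleR_sum_right)
  moreover have "T v \<bullet> T w = v \<bullet> w" for v w
    using sum.reindex_bij_betw[OF h, of "\<lambda>b. (v \<bullet> b) * (w \<bullet> b)"]
    unfolding T_def by (subst inner_orthonormal_sum[OF I(1) e]) (simp_all add: euclidean_inner[of v w])
  ultimately have T: "orthogonal_transformation T"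
    by (simp add: orthogonal_transformation_def)
  note [measurable] = borel_measurable_orthogonal_transformation[OF T]
  have hB: "h i \<in> Basis" if "i \<in> I" for i using h that by (auto simp: bij_betw_def)
  have R: "(\<lambda>x. \<lambda>i\<in>I. x (h i)) \<in> Pi\<^sub>M Basis (\<lambda>_. lborel) \<rightarrow>\<^sub>M Pi\<^sub>M I (\<lambda>_. lborel)"
    by (intro measurable_restrict measurable_component_singleton hB)
  have *: "T (\<Sum>b\<in>Basis. f b *\<^sub>R b) = (\<Sum>i\<in>I. (\<lambda>i\<in>I. f (h i)) i *\<^sub>R e i)" for f
    unfolding T_def using hB by (intro sum.cong) auto
  have "lborel = distr (distr (\<Pi>\<^sub>M b\<in>Basis. lborel) borel (\<lambda>f. \<Sum>b\<in>Basis. f b *\<^sub>R b)) borel T"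
    using distr_lborel_orthogonal[OF T] by (simp add: lborel_eq[symmetric])
  also have "\<dots> = distr (\<Pi>\<^sub>M b\<in>Basis. lborel) borel (\<lambda>f. \<Sum>i\<in>I. (\<lambda>i\<in>I. f (h i)) i *\<^sub>R e i)"
    by (subst distr_distr) (simp_all add: comp_def *)
  also have "\<dots> = distr (distr (Pi\<^sub>M Basis (\<lambda>_. lborel)) (Pi\<^sub>M I (\<lambda>_. lborel)) (\<lambda>x. \<lambda>i\<in>I. x (h i)))
      borel (\<lambda>t. \<Sum>i\<in>I. t i *\<^sub>R e i)"
    by (subst distr_distr[OF _ R]) (simp_all add: comp_def)
  also have "\<dots> = distr (Pi\<^sub>M I (\<lambda>_. lborel)) borel (\<lambda>t. \<Sum>i\<in>I. t i *\<^sub>R e i)"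
    by (subst distr_PiM_bij_betw[OF _ I(1) h]) (auto simp: sigma_finite_lborel)
  finally show ?thesis by simp
qed

section \<open>The standard Gaussian measure of a Euclidean space\<close>

abbreviation std_normal :: "real measure" where
  "std_normal \<equiv> density lborel std_normal_density"

lemma prob_space_std_normal: "prob_space std_normal"
  by (rule prob_space_normal_density) simp

text \<open>On a box the product density times the indicator factors into functions of one
  coordinate each, so both measures agree on boxes.\<close>

lemma PiM_density:
  assumes I: "finite I" and N: "sigma_finite_measure N"
    and D: "sigma_finite_measure (density N f)"
    and f[measurable]: "f \<in> borel_measurable N"
  shows "Pi\<^sub>M I (\<lambda>_. density N f) = density (Pi\<^sub>M I (\<lambda>_. N)) (\<lambda>x. \<Prod>i\<in>I. f (x i))"
proof -
  interpret sigma_finite_measure N by fact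
  interpret D: sigma_finite_measure "density N f" by fact
  interpret P: product_sigma_finite "\<lambda>_. N" by standard
  interpret D: product_sigma_finite "\<lambda>_. density N f" by standard
  note [measurable] = I
  show ?thesis
  proof (rule D.PiM_eqI[symmetric])
    show "sets (density (Pi\<^sub>M I (\<lambda>_. N)) (\<lambda>x. \<Prod>i\<in>I. f (x i))) = sets (Pi\<^sub>M I (\<lambda>_. density N f))"
      by (simp cong: sets_PiM_cong)
    fix A assume A: "\<And>i. i \<in> I \<Longrightarrow> A i \<in> sets (density N f)"
    then have [measurable]: "Pi\<^sub>E I A \<in> sets (Pi\<^sub>M I (\<lambda>_. N))" using I by (intro sets_PiM_I_finite) auto
    have "emeasure (density (Pi\<^sub>M I (\<lambda>_. N)) (\<lambda>x. \<Prod>i\<in>I. f (x i))) (Pi\<^sub>E I A)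
        = (\<integral>\<^sup>+x. (\<Prod>i\<in>I. f (x i)) * indicator (Pi\<^sub>E I A) x \<partial>Pi\<^sub>M I (\<lambda>_. N))"
      by (subst emeasure_density) simp_all
    also have "\<dots> = (\<integral>\<^sup>+x. (\<Prod>i\<in>I. f (x i) * indicator (A i) (x i)) \<partial>Pi\<^sub>M I (\<lambda>_. N))"
    proof (intro nn_integral_cong)
      fix x assume "x \<in> space (Pi\<^sub>M I (\<lambda>_. N))"
      then have "x \<in> Pi\<^sub>E I A \<longleftrightarrow> (\<forall>i\<in>I. x i \<in> A i)"
        by (auto simp: space_PiM PiE_iff)
      then have "indicator (Pi\<^sub>E I A) x = (\<Prod>i\<in>I. indicator (A i) (x i) :: ennreal)"
        using I by (cases "x \<in> Pi\<^sub>E I A") (auto simp: indicator_def)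
      then show "(\<Prod>i\<in>I. f (x i)) * indicator (Pi\<^sub>E I A) x = (\<Prod>i\<in>I. f (x i) * indicator (A i) (x i))"
        by (simp add: prod.distrib)
    qed
    also have "\<dots> = (\<Prod>i\<in>I. \<integral>\<^sup>+x. f x * indicator (A i) x \<partial>N)"
      using I A by (intro P.product_nn_integral_prod) auto
    also have "\<dots> = (\<Prod>i\<in>I. emeasure (density N f) (A i))"
      using A by (intro prod.cong) (auto simp: emeasure_density)
    finally show "emeasure (density (Pi\<^sub>M I (\<lambda>_. N)) (\<lambda>x. \<Prod>i\<in>I. f (x i))) (Pi\<^sub>E I A) =
      (\<Prod>i\<in>I. emeasure (density N f) (A i))" .
  qed (use I in simp_all)
qed

text \<open>A density in the norm alone makes invariance under orthogonal maps immediate. The link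
  with independent normal coordinates is \<open>distr_std_normal_coordinates\<close>, for every
  orthonormal basis at once.\<close>

definition gauss :: "'a::euclidean_space measure" where
  "gauss = density lborel (\<lambda>x. ennreal ((1 / sqrt (2 * pi)) ^ DIM('a) * exp (- (norm x)\<^sup>2 / 2)))"

lemma sets_gauss[simp, measurable_cong]: "sets gauss = sets borel"
  by (simp add: gauss_def)

lemma space_gauss[simp]: "space gauss = UNIV"
  by (simp add: gauss_def)

text \<open>The squared coordinates add up to the squared norm of the image point, so the product
  density is a function of that point and passes through the coordinate map, which carries Lebesgue
  measure to Lebesgue measure.\<close>

lemma distr_std_normal_coordinates:
  fixes e :: "'i \<Rightarrow> 'a::euclidean_space"
  assumes I: "finite I" "card I = DIM('a)"
    and e: "\<And>i j. i \<in> I \<Longrightarrow> j \<in> I \<Longrightarrow> e i \<bullet> e j = (if i = j then 1 else 0)"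
  shows "distr (Pi\<^sub>M I (\<lambda>_. std_normal)) borel (\<lambda>t. \<Sum>i\<in>I. t i *\<^sub>R e i) = gauss"
proof -
  let ?T = "\<lambda>t. \<Sum>i\<in>I. t i *\<^sub>R e i"
  let ?c = "1 / sqrt (2 * pi)"
  interpret prob_space std_normal by (rule prob_space_std_normal)
  have "(\<Prod>i\<in>I. ennreal (std_normal_density (t i))) = ennreal (?c ^ DIM('a) * exp (- (norm (?T t))\<^sup>2 / 2))" for t
  proof -
    have "(\<Prod>i\<in>I. std_normal_density (t i)) = ?c ^ card I * (\<Prod>i\<in>I. exp (- (t i)\<^sup>2 / 2))"
      by (simp add: std_normal_density_def prod_dividef power_divide)
    also have "(\<Prod>i\<in>I. exp (- (t i)\<^sup>2 / 2)) = exp (\<Sum>i\<in>I. - (t i)\<^sup>2 / 2)"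
      using I by (simp add: exp_sum)
    also have "(\<Sum>i\<in>I. - (t i)\<^sup>2 / 2) = - (norm (?T t))\<^sup>2 / 2"
      unfolding power2_norm_eq_inner
      by (subst inner_orthonormal_sum[OF I(1) e])
        (simp_all add: sum_negf sum_divide_distrib[symmetric] power2_eq_square)
    finally have "(\<Prod>i\<in>I. std_normal_density (t i)) = ?c ^ DIM('a) * exp (- (norm (?T t))\<^sup>2 / 2)"
      using I by simp
    then show ?thesis by (simp add: prod_ennreal)
  qed
  then have "Pi\<^sub>M I (\<lambda>_. std_normal) =
      density (Pi\<^sub>M I (\<lambda>_. lborel)) (\<lambda>t. ennreal (?c ^ DIM('a) * exp (- (norm (?T t))\<^sup>2 / 2)))"
    using I by (subst PiM_density)
      (auto simp: sigma_finite_lborel intro!: density_cong sigma_finite_measure_axioms)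
  then have "distr (Pi\<^sub>M I (\<lambda>_. std_normal)) borel ?T = density (distr (Pi\<^sub>M I (\<lambda>_. lborel)) borel ?T)
     (\<lambda>x. ennreal (?c ^ DIM('a) * exp (- (norm x)\<^sup>2 / 2)))"
    by (subst density_distr) auto
  then show ?thesis
    by (simp add: distr_lborel_coordinates[OF I e] gauss_def)
qed

lemma prob_space_gauss: "prob_space (gauss :: 'a::euclidean_space measure)"
proof -
  have "distr (Pi\<^sub>M Basis (\<lambda>_. std_normal)) borel (\<lambda>t. \<Sum>i\<in>Basis. t i *\<^sub>R i) = (gauss :: 'a measure)"
    by (rule distr_std_normal_coordinates) (auto simp: inner_Basis)
  moreover have "prob_space \<dots>"
    unfolding calculation[symmetric]
    by (intro prob_space.prob_space_distr prob_space_PiM prob_space_std_normal measurable_sum_coordinates) simp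
  ultimately show ?thesis by simp
qed

text \<open>The density at \<open>x\<close> equals the density at \<open>T x\<close>; rewritten in
  this way, it can be pulled out of the image measure.\<close>

lemma distr_gauss_orthogonal:
  fixes T :: "'a::euclidean_space \<Rightarrow> 'a"
  assumes T: "orthogonal_transformation T"
  shows "distr gauss borel T = gauss"
proof -
  note [measurable] = borel_measurable_orthogonal_transformation[OF T]
  let ?f = "\<lambda>x::'a. ennreal ((1 / sqrt (2 * pi)) ^ DIM('a) * exp (- (norm x)\<^sup>2 / 2))"
  have "distr gauss borel T = distr (density lborel (\<lambda>x. ?f (T x))) borel T"
    unfolding gauss_def by (simp only: orthogonal_transformation_norm[OF T])
  also have "\<dots> = density (distr lborel borel T) ?f"
    by (subst density_distr) auto
  also have "\<dots> = gauss"
    by (simp add: distr_lborel_orthogonal[OF T] gauss_def)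
  finally show ?thesis .
qed

text \<open>Dimensions and squared norms are both additive over pairs, so the densities multiply to
  the one on the product space. This lets a rotation mixing two vectors be handled as one orthogonal
  map.\<close>

lemma gauss_pair: "gauss \<Otimes>\<^sub>M gauss = (gauss :: ('a::euclidean_space \<times> 'b::euclidean_space) measure)"
proof -
  have sf: "sigma_finite_measure (gauss :: 'b measure)"
    by (rule prob_space_imp_sigma_finite[OF prob_space_gauss])
  have "gauss \<Otimes>\<^sub>M gauss = density (lborel \<Otimes>\<^sub>M lborel) (\<lambda>(x::'a, y::'b).
      ennreal ((1 / sqrt (2 * pi)) ^ DIM('a) * exp (- (norm x)\<^sup>2 / 2)) *
      ennreal ((1 / sqrt (2 * pi)) ^ DIM('b) * exp (- (norm y)\<^sup>2 / 2)))"
    using sf unfolding gauss_def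
    by (subst pair_measure_density) (auto simp: sigma_finite_lborel)
  also have "\<dots> = gauss"
    unfolding gauss_def lborel_prod
    by (intro arg_cong[where f = "density lborel"] ext)
      (auto simp: ennreal_mult[symmetric] norm_prod_def power_add exp_add[symmetric] add_divide_distrib)
  finally show ?thesis .
qed

subsection \<open>Gram-Schmidt residuals\<close>

text \<open>A vanishing residual contributes nothing to the later ones, since \<open>x / 0 = 0\<close>.\<close>

fun gs :: "(nat \<Rightarrow> 'a::real_inner) \<Rightarrow> nat \<Rightarrow> 'a" where
  "gs v i = v i - (\<Sum>j<i. ((v i \<bullet> gs v j) / (gs v j \<bullet> gs v j)) *\<^sub>R gs v j)"

declare gs.simps[simp del]

lemma gs_cong:
  assumes "\<And>j. j \<le> i \<Longrightarrow> v j = w j"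
  shows "gs v i = gs w i"
  using assms
proof (induction i rule: less_induct)
  case (less i)
  then have "gs v j = gs w j" if "j < i" for j using that by simp
  then show ?case using less.prems by (simp add: gs.simps[of _ i])
qed

lemma measurable_gs:
  fixes v :: "'w \<Rightarrow> nat \<Rightarrow> 'a::euclidean_space"
  assumes "\<And>j. j \<le> i \<Longrightarrow> (\<lambda>\<omega>. v \<omega> j) \<in> borel_measurable M"
  shows "(\<lambda>\<omega>. gs (v \<omega>) i) \<in> borel_measurable M"
  using assms
proof (induction i rule: less_induct)
  case (less i)
  have [measurable]: "(\<lambda>\<omega>. gs (v \<omega>) j) \<in> borel_measurable M" if "j \<in> {..<i}" for j
    using that less by simp
  have [measurable]: "(\<lambda>\<omega>. v \<omega> i) \<in> borel_measurable M" by (simp add: less.prems)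
  show ?case unfolding gs.simps[of _ i] by measurable
qed

lemma gs_orthogonal: "j < i \<Longrightarrow> gs v i \<bullet> gs v j = 0"
proof (induction i arbitrary: j rule: less_induct)
  case (less i)
  have *: "gs v k \<bullet> gs v j = 0" if "k < i" "k \<noteq> j" for k
    using that less less.IH[of k j] less.IH[of j k] by (cases k j rule: linorder_cases) (auto simp: inner_commute)
  have "gs v i \<bullet> gs v j = v i \<bullet> gs v j - (\<Sum>k<i. ((v i \<bullet> gs v k) / (gs v k \<bullet> gs v k)) * (gs v k \<bullet> gs v j))"
    by (simp add: gs.simps[of v i] inner_diff_left inner_sum_left)
  also have "(\<Sum>k<i. ((v i \<bullet> gs v k) / (gs v k \<bullet> gs v k)) * (gs v k \<bullet> gs v j))
      = (\<Sum>k<i. if k = j then v i \<bullet> gs v j else 0)"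
    by (intro sum.cong) (auto simp: *)
  also have "\<dots> = v i \<bullet> gs v j" using less.prems by simp
  finally show ?case by simp
qed

lemma gs_diff_span: "v i - gs v i \<in> span (gs v ` {..<i})"
  by (subst gs.simps[of v i]) (simp, intro span_sum span_scale span_base imageI, simp)

lemma span_insert_cong:
  assumes "span A = span B" and "c \<noteq> 0" and "x - c *\<^sub>R y \<in> span A"
  shows "span (insert x A) = span (insert y B)"
proof -
  have A: "span A \<subseteq> span (insert x A)" "span B \<subseteq> span (insert y B)" by (auto intro!: span_mono)
  have "(x - c *\<^sub>R y) + c *\<^sub>R y \<in> span (insert y B)"
    using assms(3) A unfolding assms(1) by (intro span_add span_scale) (auto intro: span_base)
  moreover have "(1 / c) *\<^sub>R (x - (x - c *\<^sub>R y)) \<in> span (insert x A)"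
    by (rule span_scale[OF span_diff[OF span_base]]) (use assms(3) A in auto)
  then have "y \<in> span (insert x A)" using assms(2) by simp
  moreover have "A \<subseteq> span (insert y B)" "B \<subseteq> span (insert x A)"
    using A assms(1) span_superset[of A] span_superset[of B] by blast+
  ultimately show ?thesis unfolding span_eq by auto
qed

text \<open>A triangular change of vectors with nonzero diagonal can be inverted on every initial
  segment. It serves three passages: to residuals, to normalized residuals, and from the edges to
  the decorrelated vectors.\<close>

lemma span_triangular:
  fixes v z :: "nat \<Rightarrow> 'a::real_vector"
  assumes "\<And>i. i < n \<Longrightarrow> c i \<noteq> 0"
    and "\<And>i. i < n \<Longrightarrow> v i - c i *\<^sub>R z i \<in> span (v ` {..<i})"
  shows "span (v ` {..<n}) = span (z ` {..<n})"
  using assms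
proof (induction n)
  case (Suc n)
  then show ?case
    unfolding lessThan_Suc image_insert by (intro span_insert_cong[of _ _ "c n"]) auto
qed simp

lemma span_gs: "span (gs v ` {..<n}) = span (v ` {..<n})"
proof (rule span_triangular[where c = "\<lambda>_. 1"])
  fix i
  have "- (v i - gs v i) \<in> span (gs v ` {..<i})" by (rule span_neg[OF gs_diff_span])
  then show "gs v i - 1 *\<^sub>R v i \<in> span (gs v ` {..<i})" by simp
qed simp

lemma gs_orthogonal_span:
  assumes "x \<in> span (v ` {..<i})"
  shows "gs v i \<bullet> x = 0"
proof -
  have "x \<in> span (gs v ` {..<i})" using assms by (simp add: span_gs)
  then show ?thesis
    by (induction rule: span_induct_alt) (auto simp: inner_add_right gs_orthogonal)
qed

text \<open>Uniqueness of orthogonal projection: the difference of two candidates lies in the span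
  and is orthogonal to it, hence to itself.\<close>

lemma gs_unique:
  assumes "v i - w \<in> span (v ` {..<i})" and "\<And>x. x \<in> span (v ` {..<i}) \<Longrightarrow> w \<bullet> x = 0"
  shows "gs v i = w"
proof -
  have "(v i - w) - (v i - gs v i) \<in> span (v ` {..<i})"
    using assms(1) gs_diff_span[of v i] unfolding span_gs by (rule span_diff)
  then have "gs v i - w \<in> span (v ` {..<i})" by simp
  then have "(gs v i - w) \<bullet> (gs v i - w) = 0"
    by (subst inner_diff_left) (simp add: assms(2) gs_orthogonal_span)
  then show ?thesis by simp
qed

text \<open>A residual sees its vector only modulo the span of the earlier ones, and
  \<open>span_triangular\<close> makes these spans equal for both families. This carries the heights
  of the edges over to the decorrelated vectors.\<close>

lemma gs_triangular:
  assumes "\<And>i. i < n \<Longrightarrow> c i \<noteq> 0"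
    and "\<And>i. i < n \<Longrightarrow> v i - c i *\<^sub>R z i \<in> span (v ` {..<i})"
    and "i < n"
  shows "gs v i = c i *\<^sub>R gs z i"
proof (rule gs_unique)
  have eq: "span (v ` {..<i}) = span (z ` {..<i})"
    using assms by (intro span_triangular[where c = c]) auto
  have "(v i - c i *\<^sub>R z i) + c i *\<^sub>R (z i - gs z i) \<in> span (v ` {..<i})"
    using assms gs_diff_span[of z i] unfolding span_gs eq[symmetric] by (intro span_add span_scale) auto
  then show "v i - c i *\<^sub>R gs z i \<in> span (v ` {..<i})" by (simp add: algebra_simps)
  show "c i *\<^sub>R gs z i \<bullet> x = 0" if "x \<in> span (v ` {..<i})" for x
    using that by (simp add: eq gs_orthogonal_span)
qed

lemma inner_gs_self: "v i \<bullet> gs v i = (norm (gs v i))\<^sup>2"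
proof -
  have "gs v i \<bullet> (v i - gs v i) = 0"
    using gs_diff_span[of v i] by (intro gs_orthogonal_span) (simp add: span_gs)
  then show ?thesis by (simp add: inner_diff_right power2_norm_eq_inner inner_commute)
qed

lemma inner_gs_less: "i < j \<Longrightarrow> v i \<bullet> gs v j = 0"
  by (subst inner_commute, rule gs_orthogonal_span) (auto intro: span_base)

text \<open>Pairing with the last residual isolates the last coefficient; once it is known to be 0,
  the sum becomes shorter.\<close>

lemma sum_scaleR_eq_0_gs:
  assumes "(\<Sum>i<n. c i *\<^sub>R v i) = 0" and "\<And>i. i < n \<Longrightarrow> gs v i \<noteq> 0" and "i < n"
  shows "c i = 0"
  using assms
proof (induction n)
  case (Suc n)
  have "(\<Sum>i<Suc n. c i *\<^sub>R v i) \<bullet> gs v n = c n * (norm (gs v n))\<^sup>2"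
    by (simp add: inner_add_left inner_sum_left inner_gs_self inner_gs_less)
  then have "c n = 0" using Suc.prems(1) Suc.prems(2)[of n] by simp
  moreover have "c i = 0" if "i < n"
    using Suc \<open>c n = 0\<close> that by simp
  ultimately show ?case using Suc.prems(3) less_Suc_eq by blast
qed simp

lemma dim_span_gs_eq_0:
  fixes v :: "nat \<Rightarrow> 'a::euclidean_space"
  assumes "gs v i = 0" and "i < n"
  shows "dim (v ` {..<n}) < n"
proof -
  have "v i \<in> span (v ` {..<i})"
    using gs_diff_span[of v i] assms(1) by (simp add: span_gs)
  also have "\<dots> \<subseteq> span (v ` ({..<n} - {i}))"
    using assms(2) by (intro span_mono image_mono) auto
  finally have "v ` {..<n} \<subseteq> span (v ` ({..<n} - {i}))"
    by (auto intro: span_base)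
  then have "dim (v ` {..<n}) \<le> dim (span (v ` ({..<n} - {i})))"
    by (rule dim_subset)
  also have "\<dots> \<le> card (v ` ({..<n} - {i}))"
    using dim_le_card'[of "v ` ({..<n} - {i})"] by (simp add: dim_span)
  also have "\<dots> \<le> card ({..<n} - {i})" by (rule card_image_le) simp
  also have "\<dots> < n" using assms(2) by simp
  finally show ?thesis .
qed

section \<open>Orthonormal frames: normalized residuals, extension, coordinates\<close>

lemma orthonormal_frameD:
  "orthonormal_frame n e \<Longrightarrow> i < n \<Longrightarrow> j < n \<Longrightarrow> e i \<bullet> e j = (if i = j then 1 else 0)"
  by (simp add: orthonormal_frame_def)

lemma orthonormal_frame_sgn_gs:
  fixes v :: "nat \<Rightarrow> 'a::euclidean_space"
  assumes nz: "\<And>i. i < n \<Longrightarrow> gs v i \<noteq> 0"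
  shows "orthonormal_frame n (\<lambda>i. sgn (gs v i))"
  unfolding orthonormal_frame_def
proof (intro allI impI)
  fix i j assume ij: "i < n" "j < n"
  have "sgn (gs v i) \<bullet> sgn (gs v i) = 1" using nz[OF ij(1)] by (simp add: norm_sgn flip: norm_eq_1)
  moreover have "sgn (gs v i) \<bullet> sgn (gs v j) = 0" if "i \<noteq> j"
    using that gs_orthogonal[of i j v] gs_orthogonal[of j i v]
    by (cases i j rule: linorder_cases) (auto simp: sgn_div_norm inner_commute)
  ultimately show "sgn (gs v i) \<bullet> sgn (gs v j) = (if i = j then 1 else 0)" by (cases "i = j") auto
qed

lemma span_sgn_gs:
  assumes nz: "\<And>i. i < n \<Longrightarrow> gs v i \<noteq> 0"
  shows "span ((\<lambda>i. sgn (gs v i)) ` {..<n}) = span (v ` {..<n})"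
proof -
  have "span ((\<lambda>i. sgn (gs v i)) ` {..<n}) = span (gs v ` {..<n})"
  proof (rule span_triangular[where c = "\<lambda>i. 1 / norm (gs v i)"])
    fix i assume "i < n"
    then show "1 / norm (gs v i) \<noteq> 0" using nz by simp
  qed (simp add: sgn_div_norm divide_inverse span_zero)
  then show ?thesis by (simp add: span_gs)
qed

lemma orthonormal_frame_extend:
  fixes e :: "nat \<Rightarrow> 'a::euclidean_space"
  assumes "orthonormal_frame k e" and "k \<le> n" and "n \<le> DIM('a)"
  obtains e' where "orthonormal_frame n e'" and "\<And>i. i < k \<Longrightarrow> e' i = e i"
proof -
  have "\<exists>e'. orthonormal_frame n e' \<and> (\<forall>i<k. e' i = e i)"
    using assms(2,3)
  proof (induction n rule: dec_induct)
    case base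
    then show ?case using assms(1) by auto
  next
    case (step n)
    then obtain e' where e': "orthonormal_frame n e'" "\<And>i. i < k \<Longrightarrow> e' i = e i" by auto
    have "dim (e' ` {..<n}) \<le> card (e' ` {..<n})" by (rule dim_le_card') simp
    also have "\<dots> \<le> n" using card_image_le[of "{..<n}" e'] by simp
    also have "\<dots> < DIM('a)" using step by simp
    finally obtain x where x: "x \<noteq> 0" "\<And>y. y \<in> span (e' ` {..<n}) \<Longrightarrow> orthogonal x y"
      using orthogonal_to_subspace_exists by blast
    have "x \<bullet> e' i = 0" if "i < n" for i
      using x(2)[of "e' i"] that by (auto simp: orthogonal_def intro: span_base)
    then have "sgn x \<bullet> e' i = 0" "e' i \<bullet> sgn x = 0" if "i < n" for i
      using that by (simp_all add: sgn_div_norm inner_commute)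
    moreover have "sgn x \<bullet> sgn x = 1"
      using x(1) by (simp add: norm_sgn flip: norm_eq_1)
    ultimately have "orthonormal_frame (Suc n) (e'(n := sgn x))"
      using e'(1) by (auto simp: orthonormal_frame_def less_Suc_eq)
    moreover have "\<forall>i<k. (e'(n := sgn x)) i = e i" using e'(2) step(1) by simp
    ultimately show ?case by blast
  qed
  then show ?thesis using that by blast
qed

lemma inner_frame_sum:
  assumes "orthonormal_frame n e" and "k \<in> I" and "I \<subseteq> {..<n}"
  shows "(\<Sum>i\<in>I. t i *\<^sub>R e i) \<bullet> e k = t k"
proof -
  have "(\<Sum>i\<in>I. t i *\<^sub>R e i) \<bullet> e k = (\<Sum>i\<in>I. if i = k then t k else 0)"
    unfolding inner_sum_left using assms by (intro sum.cong) (auto simp: orthonormal_frameD subset_eq)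
  also have "\<dots> = t k"
    using assms finite_subset[OF assms(3)] by simp
  finally show ?thesis .
qed

lemma inner_frame_sum_0:
  assumes "orthonormal_frame n e" and "k < n" and "k \<notin> I" and "I \<subseteq> {..<n}"
  shows "(\<Sum>i\<in>I. t i *\<^sub>R e i) \<bullet> e k = 0"
  unfolding inner_sum_left using assms by (intro sum.neutral) (auto simp: orthonormal_frameD subset_eq)

lemma orthonormal_frame_expansion:
  fixes e :: "nat \<Rightarrow> 'a::euclidean_space"
  assumes e: "orthonormal_frame n e" and x: "x \<in> span (e ` {..<n})"
  shows "x = (\<Sum>i<n. (x \<bullet> e i) *\<^sub>R e i)"
proof -
  let ?r = "x - (\<Sum>i<n. (x \<bullet> e i) *\<^sub>R e i)"
  have "?r \<bullet> e k = 0" if "k < n" for k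
    using inner_frame_sum[OF e, of k "{..<n}" "\<lambda>i. x \<bullet> e i"] that by (simp add: inner_diff_left)
  then have *: "?r \<bullet> e k = 0" if "k < n" for k using that by blast
  have "?r \<bullet> y = 0" if "y \<in> span (e ` {..<n})" for y
    using that
  proof (induction rule: span_induct_alt)
    case (step c x y)
    then show ?case using * by (auto simp: inner_add_right)
  qed simp
  moreover have "?r \<in> span (e ` {..<n})"
    using x by (intro span_diff span_sum span_scale) (auto intro: span_base)
  ultimately show ?thesis by (metis eq_iff_diff_eq_0 inner_eq_zero_iff)
qed

text \<open>The vectors may be dependent, so normalized residuals need not form a frame. Instead an
  orthonormal basis of the span, possibly with fewer than \<open>n\<close> elements, is padded to
  length \<open>n\<close>. This provides admissible coordinates for degenerate simplices
  too.\<close>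

lemma orthonormal_frame_span_exists:
  fixes v :: "nat \<Rightarrow> 'a::euclidean_space"
  assumes "n \<le> DIM('a)"
  obtains e where "orthonormal_frame n e" and "v ` {..<n} \<subseteq> span (e ` {..<n})"
proof -
  obtain B where B: "B \<subseteq> span (v ` {..<n})" "pairwise orthogonal B"
    "\<And>x. x \<in> B \<Longrightarrow> norm x = 1" "independent B" "card B = dim (span (v ` {..<n}))"
    "span B = span (v ` {..<n})"
    using orthonormal_basis_subspace[OF subspace_span, of "v ` {..<n}"] by blast
  have "card B \<le> card (v ` {..<n})"
    unfolding B(5) dim_span by (rule dim_le_card') simp
  also have "\<dots> \<le> n" using card_image_le[of "{..<n}" v] by simp
  finally have k: "card B \<le> n" .
  obtain e where e: "bij_betw e {..<card B} B"
    using B(4) by (metis bij_betw_from_nat_into_finite finiteI_independent)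
  have "orthonormal_frame (card B) e"
    unfolding orthonormal_frame_def
  proof (intro allI impI)
    fix i j assume ij: "i < card B" "j < card B"
    then have "e i \<in> B" "e j \<in> B" "e i = e j \<longleftrightarrow> i = j"
      using e by (auto simp: bij_betw_def inj_on_def)
    then show "e i \<bullet> e j = (if i = j then 1 else 0)"
      using B(2,3) by (auto simp: pairwise_def orthogonal_def norm_eq_1)
  qed
  then obtain e' where e': "orthonormal_frame n e'" "\<And>i. i < card B \<Longrightarrow> e' i = e i"
    using orthonormal_frame_extend[OF _ k assms] by blast
  have "B = e' ` {..<card B}" using e e'(2) by (auto simp: bij_betw_def)
  then have "span B \<subseteq> span (e' ` {..<n})" using k by (metis image_mono lessThan_subset_iff span_mono)
  moreover have "v ` {..<n} \<subseteq> span B" unfolding B(6) by (rule span_superset)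
  ultimately show ?thesis using that e'(1) by blast
qed

subsection \<open>Volume of a simplex in Cartesian coordinates\<close>

text \<open>The determinant of an upper triangular map is the product of its diagonal. The induction
  runs downwards from the empty index set at \<open>k = n\<close> and adds one coordinate at a
  time.\<close>

lemma nn_integral_lborel_triangular:
  fixes a :: "nat \<Rightarrow> nat \<Rightarrow> real"
  assumes "k \<le> n" and a: "\<And>j. k \<le> j \<Longrightarrow> j < n \<Longrightarrow> a j j > 0"
    and "f \<in> borel_measurable (Pi\<^sub>M {k..<n} (\<lambda>_. lborel))"
  shows "(\<integral>\<^sup>+x. f x \<partial>Pi\<^sub>M {k..<n} (\<lambda>_. lborel)) = (\<Prod>j\<in>{k..<n}. ennreal (a j j)) *
    (\<integral>\<^sup>+x. f (\<lambda>j\<in>{k..<n}. \<Sum>i\<in>{j..<n}. a j i * x i) \<partial>Pi\<^sub>M {k..<n} (\<lambda>_. lborel))"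
  using assms
proof (induction k arbitrary: f rule: inc_induct)
  case base
  interpret product_sigma_finite "\<lambda>_::nat. lborel :: real measure" by standard
  show ?case by (simp add: PiM_empty nn_integral_count_space_finite restrict_def)
next
  case (step k)
  interpret product_sigma_finite "\<lambda>_::nat. lborel :: real measure" by standard
  let ?I = "{Suc k..<n}"
  let ?P = "Pi\<^sub>M ?I (\<lambda>_. lborel :: real measure)"
  let ?T = "\<lambda>k x. \<lambda>j\<in>{k..<n}. \<Sum>i\<in>{j..<n}. a j i * x i"
  have ins: "{k..<n} = insert k ?I" using step(2) by auto
  have f[measurable]: "f \<in> borel_measurable (Pi\<^sub>M (insert k ?I) (\<lambda>_. lborel))"
    using step.prems(2) by (simp add: ins)
  have upd[measurable]: "(\<lambda>(x, y). f (x(k := y))) \<in> borel_measurable (?P \<Otimes>\<^sub>M lborel)"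
    using measurable_comp[OF measurable_add_dim f] by (simp add: comp_def case_prod_unfold)
  have meas_sum: "(\<lambda>x. \<Sum>i\<in>{j..<n}. a j i * x i) \<in> borel_measurable (Pi\<^sub>M {k..<n} (\<lambda>_. lborel))"
    if "k \<le> j" for k j
    using that by (intro borel_measurable_sum borel_measurable_times) auto
  have T[measurable]: "?T k \<in> Pi\<^sub>M {k..<n} (\<lambda>_. lborel) \<rightarrow>\<^sub>M Pi\<^sub>M {k..<n} (\<lambda>_. lborel)" for k
    by (rule measurable_restrict) (use meas_sum in auto)
  have fT: "(\<lambda>x. f (?T k x)) \<in> borel_measurable (Pi\<^sub>M (insert k ?I) (\<lambda>_. lborel))"
    using measurable_comp[OF T[of k], of f borel] step.prems(2) by (simp add: ins comp_def)
  \<comment> \<open>With the later coordinates fixed, row \<open>k\<close> is an affine map of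
    \<open>y\<close>: a shift depending on them and the slope \<open>a k k\<close>, so the
    one-dimensional change of variables gives the factor.\<close>
  have inner: "(\<integral>\<^sup>+y. f ((?T (Suc k) x)(k := y)) \<partial>lborel) =
      ennreal (a k k) * (\<integral>\<^sup>+y. f (?T k (x(k := y))) \<partial>lborel)" if "x \<in> space ?P" for x
  proof -
    have "?T (Suc k) x \<in> space ?P" by (auto simp: space_PiM)
    then have "(\<lambda>y. f ((?T (Suc k) x)(k := y))) \<in> borel_measurable borel"
      unfolding measurable_cong_sets[OF sets_lborel refl, symmetric]
      by (intro measurable_compose[OF measurable_component_update f]) auto
    then have "(\<integral>\<^sup>+y. f ((?T (Suc k) x)(k := y)) \<partial>lborel) = ennreal \<bar>a k k\<bar> *
        (\<integral>\<^sup>+y. f ((?T (Suc k) x)(k := (\<Sum>i\<in>?I. a k i * x i) + a k k * y)) \<partial>lborel)"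
      using step.prems(1)[of k] step(2) by (subst nn_integral_real_affine[where c = "a k k"]) auto
    moreover have "(?T (Suc k) x)(k := (\<Sum>i\<in>?I. a k i * x i) + a k k * y) = ?T k (x(k := y))" for y
      using step(2) by (fastforce simp: fun_eq_iff ins intro!: sum.cong)
    ultimately show ?thesis using step.prems(1)[of k] step(2) by simp
  qed
  have "(\<integral>\<^sup>+x. f x \<partial>Pi\<^sub>M {k..<n} (\<lambda>_. lborel)) = (\<integral>\<^sup>+x. (\<integral>\<^sup>+y. f (x(k := y)) \<partial>lborel) \<partial>?P)"
    unfolding ins by (rule product_nn_integral_insert) auto
  also have "\<dots> = (\<Prod>j\<in>?I. ennreal (a j j)) * (\<integral>\<^sup>+x. (\<integral>\<^sup>+y. f ((?T (Suc k) x)(k := y)) \<partial>lborel) \<partial>?P)"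
  proof (rule step.IH)
    show "(\<lambda>x. \<integral>\<^sup>+y. f (x(k := y)) \<partial>lborel) \<in> borel_measurable ?P"
      by (rule lborel.borel_measurable_nn_integral[OF upd])
  qed (use step.prems(1) in auto)
  also have "(\<integral>\<^sup>+x. (\<integral>\<^sup>+y. f ((?T (Suc k) x)(k := y)) \<partial>lborel) \<partial>?P) =
      (\<integral>\<^sup>+x. ennreal (a k k) * (\<integral>\<^sup>+y. f (?T k (x(k := y))) \<partial>lborel) \<partial>?P)"
    by (intro nn_integral_cong inner)
  also have "\<dots> = ennreal (a k k) * (\<integral>\<^sup>+x. (\<integral>\<^sup>+y. f (?T k (x(k := y))) \<partial>lborel) \<partial>?P)"
  proof (rule nn_integral_cmult)
    have "(\<lambda>(x, y). f (?T k (x(k := y)))) \<in> borel_measurable (?P \<Otimes>\<^sub>M lborel)"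
      using measurable_comp[OF measurable_add_dim fT] by (simp add: comp_def case_prod_unfold)
    then show "(\<lambda>x. \<integral>\<^sup>+y. f (?T k (x(k := y))) \<partial>lborel) \<in> borel_measurable ?P"
      by (rule lborel.borel_measurable_nn_integral)
  qed
  also have "(\<integral>\<^sup>+x. (\<integral>\<^sup>+y. f (?T k (x(k := y))) \<partial>lborel) \<partial>?P) =
      (\<integral>\<^sup>+x. f (?T k x) \<partial>Pi\<^sub>M (insert k ?I) (\<lambda>_. lborel))"
    by (rule product_nn_integral_insert[symmetric]) (use fT in auto)
  finally have "(\<integral>\<^sup>+x. f x \<partial>Pi\<^sub>M {k..<n} (\<lambda>_. lborel)) = (ennreal (a k k) * (\<Prod>j\<in>?I. ennreal (a j j))) *
      (\<integral>\<^sup>+x. f (?T k x) \<partial>Pi\<^sub>M {k..<n} (\<lambda>_. lborel))"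
    unfolding ins[symmetric] by (simp only: mult_ac)
  moreover have "(\<Prod>j\<in>{k..<n}. ennreal (a j j)) = ennreal (a k k) * (\<Prod>j\<in>?I. ennreal (a j j))"
    by (simp add: ins)
  ultimately show ?case by (simp only:)
qed

section \<open>Independence of the volume from the frame\<close>

lemma measurable_flat_point[measurable]:
  "flat_point l p e \<in> borel_measurable (Pi\<^sub>M {..<l} (\<lambda>_. lborel))"
  unfolding flat_point_def[abs_def] by (intro borel_measurable_add measurable_sum_coordinates) auto

text \<open>The \<open>d\<close>-dimensional volume of the thickening is the \<open>l\<close>-dimensional volume of \<open>S\<close>, and it involves
  only the directions \<open>e l, \<dots>, e (d - 1)\<close>. So the choice of coordinates inside the flat is immaterial.\<close>

definition thicken :: "nat \<Rightarrow> (nat \<Rightarrow> 'a::euclidean_space) \<Rightarrow> 'a set \<Rightarrow> 'a set" where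
  "thicken l e S = {s + (\<Sum>i\<in>{l..<DIM('a)}. c i *\<^sub>R e i) | s c.
     s \<in> S \<and> (\<forall>i\<in>{l..<DIM('a)}. c i \<in> {0..1})}"

text \<open>In the coordinates of the full frame the thickening is the product of the coordinate set
  of \<open>S\<close> with a unit cube, whose volume is 1.\<close>

lemma emeasure_thicken:
  fixes e :: "nat \<Rightarrow> 'a::euclidean_space"
  assumes e: "orthonormal_frame DIM('a) e" and l: "l \<le> DIM('a)"
    and S[measurable]: "S \<in> sets borel" and flat: "S \<subseteq> range (flat_point l p e)"
  shows "thicken l e S \<in> sets borel"
    and "emeasure lborel (thicken l e S) = emeasure (Pi\<^sub>M {..<l} (\<lambda>_. lborel))
      {t \<in> space (Pi\<^sub>M {..<l} (\<lambda>_. lborel)). flat_point l p e t \<in> S}"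
proof -
  interpret product_sigma_finite "\<lambda>_::nat. lborel :: real measure" by standard
  let ?d = "DIM('a)"
  let ?J = "{l..<?d}"
  let ?L = "Pi\<^sub>M {..<l} (\<lambda>_. lborel :: real measure)"
  let ?R = "Pi\<^sub>M ?J (\<lambda>_. lborel :: real measure)"
  let ?D = "Pi\<^sub>M {..<?d} (\<lambda>_. lborel :: real measure)"
  have ivl: "{..<?d} = {..<l} \<union> ?J" using l by auto
  \<comment> \<open>\<open>\<pi>\<close> is the orthogonal projection onto the flat. Expressing the
    thickening through it replaces the existential description by Borel conditions on
    \<open>x\<close>.\<close>
  define \<pi> where "\<pi> x = x - (\<Sum>i\<in>?J. ((x - p) \<bullet> e i) *\<^sub>R e i)" for x
  have J: "((\<Sum>i<l. t i *\<^sub>R e i) + (\<Sum>i\<in>?J. c i *\<^sub>R e i)) \<bullet> e k = c k" if "k \<in> ?J" for t c k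
    using that l inner_frame_sum[OF e, of k ?J c] inner_frame_sum_0[OF e, of k "{..<l}" t]
    by (auto simp: inner_add_left subset_eq)
  have \<pi>: "\<pi> (flat_point l p e t + (\<Sum>i\<in>?J. c i *\<^sub>R e i)) = flat_point l p e t"
    and in_J: "\<And>k. k \<in> ?J \<Longrightarrow> (flat_point l p e t + (\<Sum>i\<in>?J. c i *\<^sub>R e i) - p) \<bullet> e k = c k" for t c
    using J[of _ t c] by (simp_all add: \<pi>_def flat_point_def algebra_simps)
  have Q: "thicken l e S = {x. \<pi> x \<in> S \<and> (\<forall>i\<in>?J. (x - p) \<bullet> e i \<in> {0..1})}"
  proof (intro set_eqI iffI)
    fix x assume "x \<in> thicken l e S"
    then obtain s c where x: "x = s + (\<Sum>i\<in>?J. c i *\<^sub>R e i)" "s \<in> S" "\<forall>i\<in>?J. c i \<in> {0..1}"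
      by (auto simp: thicken_def)
    moreover obtain t where "s = flat_point l p e t" using flat x(2) by auto
    ultimately show "x \<in> {x. \<pi> x \<in> S \<and> (\<forall>i\<in>?J. (x - p) \<bullet> e i \<in> {0..1})}"
      using \<pi>[of t c] in_J[of _ t c] by simp
  next
    fix x assume "x \<in> {x. \<pi> x \<in> S \<and> (\<forall>i\<in>?J. (x - p) \<bullet> e i \<in> {0..1})}"
    then show "x \<in> thicken l e S" unfolding thicken_def
      by (intro CollectI exI[of _ "\<pi> x"] exI[of _ "\<lambda>i. (x - p) \<bullet> e i"]) (auto simp: \<pi>_def)
  qed
  have [measurable]: "\<pi> \<in> borel_measurable borel"
    unfolding \<pi>_def[abs_def] by measurable
  show meas: "thicken l e S \<in> sets borel"
    unfolding Q by measurable
  have [measurable]: "flat_point ?d p e \<in> borel_measurable ?D" by measurable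
  define A where "A = {t \<in> space ?L. flat_point l p e t \<in> S}"
  have [measurable]: "A \<in> sets ?L" unfolding A_def by measurable
  have cube[measurable]: "Pi\<^sub>E ?J (\<lambda>_. {0..1}) \<in> sets ?R" by (intro sets_PiM_I_finite) auto
  have [measurable]: "merge {..<l} ?J \<in> ?L \<Otimes>\<^sub>M ?R \<rightarrow>\<^sub>M ?D"
    unfolding ivl by (rule measurable_merge)
  have "distr ?D borel (flat_point ?d p e) = distr (distr ?D borel (\<lambda>t. \<Sum>i<?d. t i *\<^sub>R e i)) borel ((+) p)"
    by (subst distr_distr) (auto simp: comp_def flat_point_def[abs_def])
  also have "\<dots> = lborel"
    using orthonormal_frameD[OF e] by (subst distr_lborel_coordinates) (auto simp: lborel_distr_plus)
  finally have "emeasure lborel (thicken l e S) = emeasure (distr ?D borel (flat_point ?d p e)) (thicken l e S)"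
    by simp
  also have "\<dots> = emeasure (distr (distr (?L \<Otimes>\<^sub>M ?R) ?D (merge {..<l} ?J)) borel (flat_point ?d p e)) (thicken l e S)"
    unfolding ivl by (subst distr_merge) auto
  also have "\<dots> = emeasure (?L \<Otimes>\<^sub>M ?R)
      ((\<lambda>z. flat_point ?d p e (merge {..<l} ?J z)) -` thicken l e S \<inter> space (?L \<Otimes>\<^sub>M ?R))"
    using meas by (simp add: distr_distr comp_def emeasure_distr)
  also have "(\<lambda>z. flat_point ?d p e (merge {..<l} ?J z)) -` thicken l e S \<inter> space (?L \<Otimes>\<^sub>M ?R)
      = A \<times> Pi\<^sub>E ?J (\<lambda>_. {0..1})"
  proof -
    have "flat_point ?d p e (merge {..<l} ?J (x, y)) = flat_point l p e x + (\<Sum>i\<in>?J. y i *\<^sub>R e i)" for x y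
      unfolding flat_point_def ivl by (subst sum.union_disjoint) (auto simp: merge_def)
    then show ?thesis
      using in_J by (auto simp: A_def Q \<pi> space_pair_measure space_PiM PiE_iff extensional_def)
  qed
  also have "emeasure (?L \<Otimes>\<^sub>M ?R) (A \<times> Pi\<^sub>E ?J (\<lambda>_. {0..1})) = emeasure ?L A * emeasure ?R (Pi\<^sub>E ?J (\<lambda>_. {0..1}))"
    by (intro sigma_finite_measure.emeasure_pair_measure_Times sigma_finite) auto
  also have "emeasure ?R (Pi\<^sub>E ?J (\<lambda>_. {0..1})) = 1"
    by (subst emeasure_PiM) auto
  finally show "emeasure lborel (thicken l e S) = emeasure ?L {t \<in> space ?L. flat_point l p e t \<in> S}"
    by (simp add: A_def)
qed

lemma flat_point_diff_span: "flat_point l p e t - flat_point l p e u \<in> span (e ` {..<l})"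
  by (simp add: flat_point_def) (intro span_diff span_sum span_scale span_base imageI; simp)

text \<open>Both frames are completed by the same vectors orthogonal to the common span. The two
  thickenings are then literally the same set, whatever the origins \<open>p\<close> and
  \<open>p'\<close>.\<close>

lemma emeasure_flat_cong:
  fixes e e' :: "nat \<Rightarrow> 'a::euclidean_space"
  assumes e: "orthonormal_frame l e" and e': "orthonormal_frame l e'" and l: "l \<le> DIM('a)"
    and span: "span (e ` {..<l}) = span (e' ` {..<l})" and S: "S \<in> sets borel"
    and flat: "S \<subseteq> range (flat_point l p e)" "S \<subseteq> range (flat_point l p' e')"
  shows "emeasure (Pi\<^sub>M {..<l} (\<lambda>_. lborel)) {t \<in> space (Pi\<^sub>M {..<l} (\<lambda>_. lborel)). flat_point l p e t \<in> S} =
    emeasure (Pi\<^sub>M {..<l} (\<lambda>_. lborel)) {t \<in> space (Pi\<^sub>M {..<l} (\<lambda>_. lborel)). flat_point l p' e' t \<in> S}"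
proof -
  obtain f where f: "orthonormal_frame DIM('a) f" "\<And>i. i < l \<Longrightarrow> f i = e i"
    using orthonormal_frame_extend[OF e l order_refl] by blast
  define f' where "f' i = (if i < l then e' i else f i)" for i
  have "f i \<bullet> x = 0" if "l \<le> i" "i < DIM('a)" "x \<in> span (e ` {..<l})" for i x
    using that(3)
  proof (induction rule: span_induct_alt)
    case (step c y z)
    then obtain j where "j < l" "y = f j" using f(2) by auto
    then show ?case using step that orthonormal_frameD[OF f(1), of i j] l by (auto simp: inner_add_right)
  qed simp
  then have perp: "f i \<bullet> e' j = 0" if "l \<le> i" "i < DIM('a)" "j < l" for i j
    using that by (auto simp: span intro: span_base)
  have f': "orthonormal_frame DIM('a) f'"
    using e' f(1) perp unfolding orthonormal_frame_def f'_def by (auto simp: inner_commute)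
  have fp: "flat_point l p f = flat_point l p e" "flat_point l p' f' = flat_point l p' e'"
    using f(2) by (auto simp: flat_point_def f'_def fun_eq_iff)
  have "thicken l f S = thicken l f' S"
    by (simp add: thicken_def f'_def)
  then show ?thesis
    using emeasure_thicken(2)[OF f(1) l S, of p] emeasure_thicken(2)[OF f' l S, of p'] flat by (simp add: fp)
qed

text \<open>The thickening lies in a translate of a subspace spanned by \<open>dim V\<close> vectors
  and the \<open>DIM('a) - l\<close> complementary ones, fewer than \<open>DIM('a)\<close> in all,
  so it is a null set.\<close>

lemma emeasure_flat_degenerate:
  fixes e :: "nat \<Rightarrow> 'a::euclidean_space"
  assumes e: "orthonormal_frame l e" and l: "l \<le> DIM('a)"
    and S: "S \<in> sets borel" and flat: "S \<subseteq> range (flat_point l p e)"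
    and V: "\<And>x. x \<in> S \<Longrightarrow> x - q \<in> span V" "dim V < l"
  shows "emeasure (Pi\<^sub>M {..<l} (\<lambda>_. lborel)) {t \<in> space (Pi\<^sub>M {..<l} (\<lambda>_. lborel)). flat_point l p e t \<in> S} = 0"
proof -
  obtain f where f: "orthonormal_frame DIM('a) f" "\<And>i. i < l \<Longrightarrow> f i = e i"
    using orthonormal_frame_extend[OF e l order_refl] by blast
  have fp: "flat_point l p f = flat_point l p e"
    using f(2) by (auto simp: flat_point_def fun_eq_iff)
  obtain B where B: "B \<subseteq> V" "independent B" "V \<subseteq> span B" "card B = dim V" by (rule basis_exists)
  have VB: "span V \<subseteq> span B" using B(3) by (simp add: span_minimal)
  let ?F = "f ` {l..<DIM('a)}"
  have finB: "finite B" using B(2) by (rule finiteI_independent)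
  have "dim (B \<union> ?F) \<le> card (B \<union> ?F)" using finB by (intro dim_le_card') auto
  also have "\<dots> \<le> card B + card ?F" by (rule card_Un_le)
  also have "card ?F \<le> DIM('a) - l" using card_image_le[of "{l..<DIM('a)}" f] by simp
  finally have "dim (span (B \<union> ?F)) < DIM('a)" using B(4) V(2) l by (simp add: dim_span)
  then have "negligible ((+) q ` span (B \<union> ?F))"
    by (intro negligible_translation negligible_lowdim)
  moreover have "thicken l f S \<subseteq> (+) q ` span (B \<union> ?F)"
  proof
    fix x assume "x \<in> thicken l f S"
    then obtain s c where x: "x = s + (\<Sum>i\<in>{l..<DIM('a)}. c i *\<^sub>R f i)" "s \<in> S"
      by (auto simp: thicken_def)
    have "s - q \<in> span (B \<union> ?F)" using V(1)[OF x(2)] VB span_mono[of B "B \<union> ?F"] by blast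
    moreover have "(\<Sum>i\<in>{l..<DIM('a)}. c i *\<^sub>R f i) \<in> span (B \<union> ?F)"
      by (intro span_sum span_scale span_base) auto
    ultimately have "(s - q) + (\<Sum>i\<in>{l..<DIM('a)}. c i *\<^sub>R f i) \<in> span (B \<union> ?F)" by (rule span_add)
    then have "x - q \<in> span (B \<union> ?F)" by (simp add: x(1) add_diff_eq diff_add_eq)
    then show "x \<in> (+) q ` span (B \<union> ?F)" by (intro image_eqI[of _ _ "x - q"]) auto
  qed
  ultimately have "negligible (thicken l f S)" by (rule negligible_subset)
  then have "thicken l f S \<in> null_sets lebesgue" by (simp add: negligible_iff_null_sets)
  then have "emeasure lborel (thicken l f S) = 0"
    using emeasure_thicken(1)[OF f(1) l S, of p] flat by (auto simp: null_sets_def fp)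
  then show ?thesis
    using emeasure_thicken(2)[OF f(1) l S, of p] flat by (simp add: fp)
qed

section \<open>Simplices\<close>

lemma convex_hull_simplex:
  fixes x :: "nat \<Rightarrow> 'a::real_vector"
  shows "convex hull (x ` {0..n}) =
    {x 0 + (\<Sum>i<n. s i *\<^sub>R (x (Suc i) - x 0)) | s. (\<forall>i<n. 0 \<le> s i) \<and> (\<Sum>i<n. s i) \<le> 1}" (is "_ = ?S")
proof (rule antisym)
  have "convex ?S"
  proof (rule convexI)
    fix y z and u w :: real assume uw: "0 \<le> u" "0 \<le> w" "u + w = 1" and "y \<in> ?S" "z \<in> ?S"
    then obtain s t where y: "y = x 0 + (\<Sum>i<n. s i *\<^sub>R (x (Suc i) - x 0))" "\<forall>i<n. 0 \<le> s i" "(\<Sum>i<n. s i) \<le> 1"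
      and z: "z = x 0 + (\<Sum>i<n. t i *\<^sub>R (x (Suc i) - x 0))" "\<forall>i<n. 0 \<le> t i" "(\<Sum>i<n. t i) \<le> 1"
      by blast
    have "u *\<^sub>R y + w *\<^sub>R z = (u + w) *\<^sub>R x 0 + (\<Sum>i<n. (u * s i + w * t i) *\<^sub>R (x (Suc i) - x 0))"
      by (simp add: y(1) z(1) scaleR_add_left scaleR_add_right sum.distrib scaleR_sum_right)
    moreover have "(\<Sum>i<n. u * s i + w * t i) \<le> u * 1 + w * 1"
      unfolding sum.distrib sum_distrib_left[symmetric]
      using uw y(3) z(3) by (intro add_mono mult_left_mono)
    ultimately show "u *\<^sub>R y + w *\<^sub>R z \<in> ?S"
      using uw y(2) z(2) by (intro CollectI exI[of _ "\<lambda>i. u * s i + w * t i"]) auto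
  qed
  moreover have "x ` {0..n} \<subseteq> ?S"
  proof
    fix y assume "y \<in> x ` {0..n}"
    then obtain k where k: "k \<le> n" "y = x k" by auto
    show "y \<in> ?S"
    proof (cases k)
      case 0
      then show ?thesis using k by (intro CollectI exI[of _ "\<lambda>_. 0"]) auto
    next
      case (Suc j)
      have "(\<Sum>i<n. (if i = j then 1 else 0) *\<^sub>R (x (Suc i) - x 0)) = (\<Sum>i<n. if i = j then x (Suc j) - x 0 else 0)"
        by (intro sum.cong) auto
      then show ?thesis using k Suc
        by (intro CollectI exI[of _ "\<lambda>i. if i = j then 1 else 0"]) auto
    qed
  qed
  ultimately show "convex hull (x ` {0..n}) \<subseteq> ?S" by (intro hull_minimal)
  show "?S \<subseteq> convex hull (x ` {0..n})"
  proof
    fix y assume "y \<in> ?S"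
    then obtain s where y: "y = x 0 + (\<Sum>i<n. s i *\<^sub>R (x (Suc i) - x 0))" and s: "\<forall>i<n. 0 \<le> s i" "(\<Sum>i<n. s i) \<le> 1"
      by blast
    \<comment> \<open>The vertex \<open>x 0\<close> takes the weight left over by the other
      vertices.\<close>
    let ?w = "\<lambda>i. case i of 0 \<Rightarrow> 1 - (\<Sum>i<n. s i) | Suc i \<Rightarrow> s i"
    have "y = (\<Sum>i\<le>n. ?w i *\<^sub>R x i)"
      by (simp add: y sum.atMost_shift algebra_simps sum_subtractf scaleR_sum_left)
    also have "\<dots> \<in> convex hull (x ` {0..n})"
      using s by (intro convex_sum) (auto simp: sum.atMost_shift hull_inc split: nat.split)
    finally show "y \<in> convex hull (x ` {0..n})" .
  qed
qed

text \<open>In the frame of normalized residuals the edges have upper triangular coordinates with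
  diagonal \<open>norm (gs v j)\<close>. The simplex is therefore a triangular image of the standard
  simplex, which has volume \<open>1 / fact n\<close>.\<close>

lemma emeasure_simplex_coordinates:
  fixes v :: "nat \<Rightarrow> 'a::euclidean_space" and p :: 'a
  assumes nz: "\<And>i. i < n \<Longrightarrow> gs v i \<noteq> 0"
  defines "e \<equiv> \<lambda>i. sgn (gs v i)"
    and "S \<equiv> {p + (\<Sum>i<n. s i *\<^sub>R v i) | s. (\<forall>i<n. 0 \<le> s i) \<and> (\<Sum>i<n. s i) \<le> 1}"
  assumes S[measurable]: "S \<in> sets borel"
  shows "orthonormal_frame n e" and "S \<subseteq> range (flat_point n p e)"
    and "emeasure (Pi\<^sub>M {..<n} (\<lambda>_. lborel)) {t \<in> space (Pi\<^sub>M {..<n} (\<lambda>_. lborel)). flat_point n p e t \<in> S}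
      = ennreal ((\<Prod>i<n. norm (gs v i)) / fact n)"
proof -
  let ?L = "Pi\<^sub>M {..<n} (\<lambda>_. lborel :: real measure)"
  show e: "orthonormal_frame n e"
    unfolding e_def by (rule orthonormal_frame_sgn_gs) (rule nz)
  have span_e: "span (e ` {..<n}) = span (v ` {..<n})"
    unfolding e_def by (rule span_sgn_gs) (rule nz)
  define a where "a j i = v i \<bullet> e j" for j i
  have a_less: "a j i = 0" if "i < j" for i j
    using inner_gs_less[OF that, of v] by (simp add: a_def e_def sgn_div_norm)
  have a_diag: "a j j = norm (gs v j)" if "j < n" for j
    using nz[OF that] inner_gs_self[of v j] by (simp add: a_def e_def sgn_div_norm power2_eq_square)
  have v_eq: "v i = (\<Sum>j<n. a j i *\<^sub>R e j)" if "i < n" for i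
    unfolding a_def by (rule orthonormal_frame_expansion[OF e]) (use that in \<open>auto simp: span_e intro: span_base\<close>)
  let ?T = "\<lambda>s. \<lambda>j\<in>{0..<n}. \<Sum>i\<in>{j..<n}. a j i * s i"
  have flat_T: "flat_point n p e (?T s) = p + (\<Sum>i<n. s i *\<^sub>R v i)" for s
  proof -
    have "(\<Sum>j<n. ?T s j *\<^sub>R e j) = (\<Sum>j<n. \<Sum>i<n. (s i * a j i) *\<^sub>R e j)"
    proof (rule sum.cong)
      fix j assume j: "j \<in> {..<n}"
      have "(\<Sum>i\<in>{j..<n}. a j i * s i) = (\<Sum>i<n. a j i * s i)"
        using j by (intro sum.mono_neutral_left) (auto simp: a_less)
      then show "?T s j *\<^sub>R e j = (\<Sum>i<n. (s i * a j i) *\<^sub>R e j)"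
        using j by (simp add: scaleR_sum_left mult.commute)
    qed simp
    also have "\<dots> = (\<Sum>i<n. \<Sum>j<n. (s i * a j i) *\<^sub>R e j)" by (rule sum.swap)
    also have "\<dots> = (\<Sum>i<n. s i *\<^sub>R v i)"
      by (intro sum.cong) (simp_all add: v_eq scaleR_sum_right)
    finally show ?thesis by (simp add: flat_point_def)
  qed
  show "S \<subseteq> range (flat_point n p e)"
  proof
    fix y assume "y \<in> S"
    then obtain s where "y = flat_point n p e (?T s)" using flat_T by (auto simp: S_def)
    then show "y \<in> range (flat_point n p e)" by simp
  qed
  define A where "A = {t \<in> space ?L. flat_point n p e t \<in> S}"
  have [measurable]: "A \<in> sets ?L" unfolding A_def by measurable
  define \<Delta> where "\<Delta> = {s. (\<forall>i\<in>{..<n}. 0 \<le> s i) \<and> sum s {..<n} \<le> (1::real)} \<inter> space ?L"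
  have \<Delta>: "emeasure ?L \<Delta> = ennreal (1 / fact n)"
    unfolding \<Delta>_def by (subst emeasure_std_simplex_aux) auto
  \<comment> \<open>Membership of the image point yields only some admissible coefficients
    \<open>u\<close>. Nonzero residuals make the edges independent, so \<open>u\<close> agrees with
    \<open>s\<close>.\<close>
  have T_iff: "?T s \<in> A \<longleftrightarrow> s \<in> \<Delta>" if s: "s \<in> space ?L" for s
  proof
    assume "s \<in> \<Delta>"
    then show "?T s \<in> A" using flat_T[of s] by (auto simp: A_def \<Delta>_def S_def space_PiM atLeast0LessThan)
  next
    assume "?T s \<in> A"
    then have "p + (\<Sum>i<n. s i *\<^sub>R v i) \<in> S" using flat_T[of s] by (simp add: A_def)
    then obtain u where u: "(\<Sum>i<n. s i *\<^sub>R v i) = (\<Sum>i<n. u i *\<^sub>R v i)" "\<forall>i<n. 0 \<le> u i" "(\<Sum>i<n. u i) \<le> 1"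
      by (auto simp: S_def)
    have "(\<Sum>i<n. (s i - u i) *\<^sub>R v i) = 0"
      using u(1) by (simp add: scaleR_diff_left sum_subtractf)
    then have "s i = u i" if "i < n" for i
      using sum_scaleR_eq_0_gs[of "\<lambda>i. s i - u i" v n i] nz that by auto
    then show "s \<in> \<Delta>" using u s by (auto simp: \<Delta>_def)
  qed
  have "emeasure ?L A = (\<integral>\<^sup>+t. indicator A t \<partial>?L)" by simp
  also have "\<dots> = (\<Prod>j\<in>{0..<n}. ennreal (a j j)) * (\<integral>\<^sup>+s. indicator A (?T s) \<partial>?L)"
    unfolding lessThan_atLeast0 using nz a_diag
    by (intro nn_integral_lborel_triangular) (auto simp flip: lessThan_atLeast0)
  also have "(\<integral>\<^sup>+s. indicator A (?T s) \<partial>?L) = (\<integral>\<^sup>+s. indicator \<Delta> s \<partial>?L)"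
    by (intro nn_integral_cong) (simp add: indicator_def T_iff)
  also have "\<dots> = ennreal (1 / fact n)"
  proof -
    \<comment> \<open>A nonmeasurable set would have \<open>emeasure\<close> 0, whereas this value
      is positive.\<close>
    have "\<Delta> \<in> sets ?L" using \<Delta> emeasure_notin_sets[of \<Delta> ?L] by force
    then show ?thesis by (simp add: \<Delta>)
  qed
  also have "(\<Prod>j\<in>{0..<n}. ennreal (a j j)) = ennreal (\<Prod>j<n. norm (gs v j))"
    unfolding lessThan_atLeast0 by (subst prod_ennreal[symmetric]) (auto simp: a_diag intro!: prod.cong)
  finally show "emeasure ?L {t \<in> space ?L. flat_point n p e t \<in> S} = ennreal ((\<Prod>i<n. norm (gs v i)) / fact n)"
    by (simp add: A_def prod_nonneg flip: ennreal_mult)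
qed

text \<open>For the definite description one needs a frame whose flat contains the simplex, and the
  same value in all such frames. If no residual vanishes, the frame of normalized residuals is the
  reference. Otherwise admissible frames may span different subspaces, but all give 0, as does the
  product.\<close>

lemma volume_dim_simplex:
  fixes x :: "nat \<Rightarrow> 'a::euclidean_space"
  assumes l: "l \<le> DIM('a)"
  defines "v \<equiv> \<lambda>i. x (Suc i) - x 0"
  shows "volume_dim l (convex hull (x ` {0..l})) = (\<Prod>i<l. norm (gs v i)) / fact l"
proof -
  let ?S = "convex hull (x ` {0..l})"
  let ?L = "Pi\<^sub>M {..<l} (\<lambda>_. lborel :: real measure)"
  let ?vol = "(\<Prod>i<l. norm (gs v i)) / fact l"
  have S: "?S \<in> sets borel"
    by (intro borel_closed compact_imp_closed compact_convex_hull finite_imp_compact) simp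
  have S_eq: "?S = {x 0 + (\<Sum>i<l. s i *\<^sub>R v i) | s. (\<forall>i<l. 0 \<le> s i) \<and> (\<Sum>i<l. s i) \<le> 1}"
    unfolding v_def by (rule convex_hull_simplex)
  have v_span: "y - x 0 \<in> span (v ` {..<l})" if "y \<in> ?S" for y
    using that unfolding S_eq by (auto, intro span_sum span_scale span_base imageI, simp)
  have *: "measure ?L {t \<in> space ?L. flat_point l p e t \<in> ?S} = ?vol"
    if e: "orthonormal_frame l e" and flat: "?S \<subseteq> range (flat_point l p e)" for p e
  proof (cases "\<forall>i<l. gs v i \<noteq> 0")
    case True
    have nz: "gs v i \<noteq> 0" if "i < l" for i using True that by simp
    note c = emeasure_simplex_coordinates[of l v "x 0", folded S_eq, OF nz S]
    let ?e = "\<lambda>i. sgn (gs v i)"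
    have c1: "orthonormal_frame l ?e" and c2: "?S \<subseteq> range (flat_point l (x 0) ?e)"
      and c3: "emeasure ?L {t \<in> space ?L. flat_point l (x 0) ?e t \<in> ?S} = ennreal ?vol"
      by (simp_all only: c)
    \<comment> \<open>Edges are differences of points of the flat, so their span is contained in
      that of \<open>e'\<close>; the dimensions, \<open>l\<close> and at most \<open>l\<close>,
      force equality.\<close>
    have same: "span (e' ` {..<l}) = span (v ` {..<l})"
      if e': "orthonormal_frame l e'" "?S \<subseteq> range (flat_point l p' e')" for p' e'
    proof -
      have "v i \<in> span (e' ` {..<l})" if "i < l" for i
      proof -
        have "x (Suc i) \<in> ?S" "x 0 \<in> ?S" using that by (auto intro!: hull_inc)
        then obtain t u where "x (Suc i) = flat_point l p' e' t" "x 0 = flat_point l p' e' u"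
          using e'(2) by blast
        then show ?thesis using flat_point_diff_span[of l p' e' t u] by (simp add: v_def)
      qed
      then have sub: "span (v ` {..<l}) \<subseteq> span (e' ` {..<l})"
        by (intro span_minimal) auto
      have "l \<le> dim (v ` {..<l})"
      proof -
        have "pairwise orthogonal (gs v ` {..<l})"
          by (auto simp: pairwise_def orthogonal_def) (metis gs_orthogonal inner_commute linorder_neqE_nat)
        moreover have "0 \<notin> gs v ` {..<l}" using True by force
        ultimately have "independent (gs v ` {..<l})" by (rule pairwise_orthogonal_independent)
        moreover have "inj_on (gs v) {..<l}"
        proof (rule inj_onI)
          fix i j assume ij: "i \<in> {..<l}" "j \<in> {..<l}" "gs v i = gs v j"
          then show "i = j" using True gs_orthogonal[of i j v] gs_orthogonal[of j i v]
            by (cases i j rule: linorder_cases) auto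
        qed
        ultimately have "dim (gs v ` {..<l}) = l" by (simp add: dim_eq_card_independent card_image)
        then show ?thesis by (metis dim_span order_refl span_gs)
      qed
      moreover have "dim (e' ` {..<l}) \<le> l"
        using dim_le_card'[of "e' ` {..<l}"] card_image_le[of "{..<l}" e'] by simp
      ultimately show ?thesis
        using sub by (intro subspace_dim_equal[symmetric]) (auto simp: dim_span)
    qed
    have "emeasure ?L {t \<in> space ?L. flat_point l p e t \<in> ?S} = ennreal ?vol"
      using emeasure_flat_cong[OF e c1 l _ S flat c2] same[OF e flat] same[OF c1 c2] c3 by simp
    then show ?thesis by (simp add: measure_def prod_nonneg)
  next
    case False
    then obtain i where i: "i < l" "gs v i = 0" by blast
    have "emeasure ?L {t \<in> space ?L. flat_point l p e t \<in> ?S} = 0"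
      using v_span dim_span_gs_eq_0[OF i(2,1)] by (intro emeasure_flat_degenerate[OF e l S flat]) auto
    moreover have "(\<Prod>i<l. norm (gs v i)) = 0" using i by auto
    ultimately show ?thesis by (simp add: measure_def)
  qed
  obtain e where e: "orthonormal_frame l e" "v ` {..<l} \<subseteq> span (e ` {..<l})"
    using orthonormal_frame_span_exists[OF l] by blast
  have flat: "?S \<subseteq> range (flat_point l (x 0) e)"
  proof
    fix y assume "y \<in> ?S"
    then have "y - x 0 \<in> span (e ` {..<l})"
      using v_span span_minimal[OF e(2) subspace_span] by blast
    then have "y - x 0 = (\<Sum>i<l. ((y - x 0) \<bullet> e i) *\<^sub>R e i)" by (rule orthonormal_frame_expansion[OF e(1)])
    then have "y = flat_point l (x 0) e (\<lambda>i. (y - x 0) \<bullet> e i)" by (simp add: flat_point_def algebra_simps)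
    then show "y \<in> range (flat_point l (x 0) e)" by (metis rangeI)
  qed
  show ?thesis
    unfolding volume_dim_def
  proof (rule the_equality)
    show "\<exists>p e. orthonormal_frame l e \<and> ?S \<subseteq> range (flat_point l p e) \<and>
        ?vol = measure ?L {t \<in> space ?L. flat_point l p e t \<in> ?S}"
      using e(1) flat *[OF e(1) flat, symmetric] by blast
  qed (use * in blast)
qed

subsection \<open>Residuals of independent Gaussian vectors\<close>

lemma measurable_norm_gs:
  fixes v :: "'w \<Rightarrow> nat \<Rightarrow> 'a::euclidean_space"
  assumes "\<And>j. j \<le> i \<Longrightarrow> (\<lambda>\<omega>. v \<omega> j) \<in> borel_measurable M"
  shows "(\<lambda>\<omega>. norm (gs (v \<omega>) i)) \<in> borel_measurable M"
  by (rule measurable_compose[OF measurable_gs borel_measurable_norm]) (rule assms)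

lemma measurable_norm_gs_PiM:
  assumes "i < n"
  shows "(\<lambda>z. norm (gs z i)) \<in> borel_measurable (Pi\<^sub>M {..<n} (\<lambda>_. gauss :: 'a::euclidean_space measure))"
proof (rule measurable_norm_gs)
  fix j assume "j \<le> i"
  then show "(\<lambda>z. z j) \<in> borel_measurable (Pi\<^sub>M {..<n} (\<lambda>_. gauss :: 'a measure))"
    using assms measurable_component_singleton[of j "{..<n}" "\<lambda>_. gauss :: 'a measure"]
    by (simp add: measurable_cong_sets[OF refl sets_gauss])
qed

lemma measurable_norm_gs_upd:
  fixes z :: "nat \<Rightarrow> 'a::euclidean_space"
  shows "(\<lambda>x. norm (gs (z(n := x)) n)) \<in> borel_measurable borel"
proof (rule measurable_norm_gs)
  fix j
  show "(\<lambda>x. (z(n := x)) j) \<in> borel_measurable borel" by (cases "j = n") auto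
qed

lemma prob_space_chi_distribution: "prob_space (chi_distribution k)"
  unfolding chi_distribution_def L2_set_def
  by (intro prob_space.prob_space_distr prob_space_PiM prob_space_std_normal) measurable

lemma sets_chi_distribution[simp, measurable_cong]: "sets (chi_distribution k) = sets borel"
  by (simp add: chi_distribution_def)

text \<open>The norm vanishes only at the origin, a box with null sides. For \<open>k = 0\<close>
  the law would be the point mass at 0. This yields almost surely nonzero residuals, as
  \<open>distr_norm_gs_gauss\<close> requires.\<close>

lemma emeasure_chi_distribution_nonzero:
  assumes "k > 0"
  shows "emeasure (chi_distribution k) (- {0}) = 1"
proof -
  interpret std_normal: prob_space std_normal by (rule prob_space_std_normal)
  interpret product_sigma_finite "\<lambda>_::nat. std_normal" by standard
  interpret prob_space "chi_distribution k" by (rule prob_space_chi_distribution)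
  let ?P = "Pi\<^sub>M {..<k} (\<lambda>_. std_normal)"
  have "emeasure std_normal {0} = (\<integral>\<^sup>+x. ennreal (std_normal_density x) * indicator {0} x \<partial>lborel)"
    by (subst emeasure_density) auto
  also have "\<dots> = 0"
    by (subst nn_integral_indicator_singleton) auto
  finally have zero: "emeasure std_normal {0} = 0" .
  have [measurable]: "(\<lambda>x. L2_set x {..<k}) \<in> borel_measurable ?P"
    unfolding L2_set_def by measurable
  have "(\<lambda>x. L2_set x {..<k}) -` {0} \<inter> space ?P = Pi\<^sub>E {..<k} (\<lambda>_. {0})"
    by (intro set_eqI)
      (simp only: vimage_eq Int_iff space_PiM PiE_iff singleton_iff, auto simp: L2_set_eq_0_iff)
  then have "emeasure (chi_distribution k) {0} = emeasure ?P (Pi\<^sub>E {..<k} (\<lambda>_. {0}))"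
    by (simp add: chi_distribution_def emeasure_distr)
  also have "\<dots> = 0"
    using assms zero by (subst emeasure_PiM) auto
  finally have "prob {0} = 0" by (simp add: measure_def)
  then have "prob (space (chi_distribution k) - {0}) = 1"
    by (subst prob_compl) auto
  moreover have "space (chi_distribution k) = UNIV" by (simp add: chi_distribution_def)
  ultimately show ?thesis by (simp add: emeasure_eq_measure Compl_eq_Diff_UNIV)
qed

text \<open>In an orthonormal frame whose first \<open>n\<close> vectors span those of \<open>z\<close>, the residual keeps the last
  \<open>d - n\<close> coordinates of the Gaussian vector.\<close>

lemma distr_norm_gs_gauss:
  fixes z :: "nat \<Rightarrow> 'a::euclidean_space"
  assumes n: "n \<le> DIM('a)" and nz: "\<And>i. i < n \<Longrightarrow> gs z i \<noteq> 0"
  shows "distr gauss borel (\<lambda>x. norm (gs (z(n := x)) n)) = chi_distribution (DIM('a) - n)"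
proof -
  let ?d = "DIM('a)"
  let ?D = "Pi\<^sub>M {..<?d} (\<lambda>_. std_normal)"
  let ?I = "{..<?d - n}"
  obtain f where f: "orthonormal_frame ?d f" "\<And>i. i < n \<Longrightarrow> f i = sgn (gs z i)"
    using orthonormal_frame_extend[OF orthonormal_frame_sgn_gs[OF nz] n order_refl] by blast
  have "f ` {..<n} = (\<lambda>i. sgn (gs z i)) ` {..<n}" using f(2) by auto
  then have span_f: "span (f ` {..<n}) = span (z ` {..<n})" using span_sgn_gs[OF nz] by simp
  let ?T = "\<lambda>t. \<Sum>i<?d. t i *\<^sub>R f i"
  have T: "distr ?D borel ?T = gauss"
    using orthonormal_frameD[OF f(1)] by (intro distr_std_normal_coordinates) auto
  have split: "?T t = (\<Sum>i<n. t i *\<^sub>R f i) + (\<Sum>i\<in>{n..<?d}. t i *\<^sub>R f i)" for t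
    using sum.atLeastLessThan_concat[of 0 n ?d "\<lambda>i. t i *\<^sub>R f i"] n by (simp add: lessThan_atLeast0)
  have upd: "(z(n := x)) ` {..<n} = z ` {..<n}" for x by auto
  have gs_T: "gs (z(n := ?T t)) n = (\<Sum>i\<in>{n..<?d}. t i *\<^sub>R f i)" for t
  proof (rule gs_unique)
    show "(z(n := ?T t)) n - (\<Sum>i\<in>{n..<?d}. t i *\<^sub>R f i) \<in> span ((z(n := ?T t)) ` {..<n})"
      unfolding upd span_f[symmetric] by (simp add: split, intro span_sum span_scale span_base imageI, simp)
    fix x assume "x \<in> span ((z(n := ?T t)) ` {..<n})"
    then have "x \<in> span (f ` {..<n})" unfolding upd span_f .
    then show "(\<Sum>i\<in>{n..<?d}. t i *\<^sub>R f i) \<bullet> x = 0"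
    proof (induction rule: span_induct_alt)
      case (step c x y)
      then obtain k where "k < n" "x = f k" by auto
      then show ?case
        using step inner_frame_sum_0[OF f(1), of k "{n..<?d}" t] n by (simp add: inner_add_right subset_eq)
    qed simp
  qed
  \<comment> \<open>The surviving coordinates \<open>n, ..., d - 1\<close> are shifted down by
    \<open>n\<close> to match the index set in \<open>chi_distribution\<close>.\<close>
  have norm_T: "norm (gs (z(n := ?T t)) n) = L2_set (\<lambda>i\<in>?I. t (i + n)) ?I" for t
  proof -
    have "(norm (\<Sum>i\<in>{n..<?d}. t i *\<^sub>R f i))\<^sup>2 = (\<Sum>i\<in>{n..<?d}. (t i)\<^sup>2)"
      unfolding power2_norm_eq_inner using orthonormal_frameD[OF f(1)]
      by (subst inner_orthonormal_sum) (auto simp: power2_eq_square)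
    also have "\<dots> = (\<Sum>i\<in>?I. (t (i + n))\<^sup>2)"
      using n sum.shift_bounds_nat_ivl[of "\<lambda>i. (t i)\<^sup>2" 0 n "?d - n"] by (simp add: lessThan_atLeast0)
    finally show ?thesis
      unfolding gs_T L2_set_def by (simp add: real_sqrt_unique)
  qed
  have [measurable]: "(\<lambda>x. norm (gs (z(n := x)) n)) \<in> borel_measurable borel"
    by (rule measurable_norm_gs_upd)
  have L2[measurable]: "(\<lambda>x. L2_set x ?I) \<in> borel_measurable (Pi\<^sub>M ?I (\<lambda>_. std_normal))"
    unfolding L2_set_def by measurable
  have R: "(\<lambda>t. \<lambda>i\<in>?I. t (i + n)) \<in> ?D \<rightarrow>\<^sub>M Pi\<^sub>M ?I (\<lambda>_. std_normal)"
    by (intro measurable_restrict measurable_component_singleton) auto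
  have "distr gauss borel (\<lambda>x. norm (gs (z(n := x)) n)) = distr ?D borel (\<lambda>t. norm (gs (z(n := ?T t)) n))"
    unfolding T[symmetric] by (subst distr_distr) (auto simp: comp_def intro!: measurable_sum_coordinates)
  also have "\<dots> = distr (distr ?D (Pi\<^sub>M ?I (\<lambda>_. std_normal)) (\<lambda>t. \<lambda>i\<in>?I. t (i + n))) borel (\<lambda>x. L2_set x ?I)"
    unfolding norm_T by (subst distr_distr[OF L2 R]) (simp add: comp_def)
  also have "distr ?D (Pi\<^sub>M ?I (\<lambda>_. std_normal)) (\<lambda>t. \<lambda>i\<in>?I. t (i + n)) = Pi\<^sub>M ?I (\<lambda>_. std_normal)"
    by (rule distr_PiM_reindex) (auto simp: prob_space_std_normal)
  finally show ?thesis unfolding chi_distribution_def .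
qed

text \<open>The law of the next height is the same for almost all choices of the first
  \<open>n\<close> vectors, so its factor leaves the integral. Independence of the heights is this
  factorization.\<close>

lemma emeasure_norm_gs_gauss:
  assumes "n \<le> DIM('a)" and "\<And>i. i < n \<Longrightarrow> A i \<in> sets borel"
  shows "emeasure (Pi\<^sub>M {..<n} (\<lambda>_. gauss :: 'a::euclidean_space measure))
      {z \<in> space (Pi\<^sub>M {..<n} (\<lambda>_. gauss)). \<forall>i<n. norm (gs z i) \<in> A i}
    = (\<Prod>i<n. emeasure (chi_distribution (DIM('a) - i)) (A i))"
  using assms
proof (induction n arbitrary: A)
  case 0
  interpret prob_space "Pi\<^sub>M {} (\<lambda>_. gauss :: 'a measure)"
    by (intro prob_space_PiM prob_space_gauss)
  show ?case using emeasure_space_1 by (simp add: lessThan_0)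
next
  case (Suc n)
  interpret gauss: prob_space "gauss :: 'a measure" by (rule prob_space_gauss)
  interpret product_sigma_finite "\<lambda>_::nat. gauss :: 'a measure" by standard
  let ?P = "\<lambda>n. Pi\<^sub>M {..<n} (\<lambda>_. gauss :: 'a measure)"
  interpret P: prob_space "?P n" by (intro prob_space_PiM prob_space_gauss)
  let ?\<chi> = "\<lambda>i. chi_distribution (DIM('a) - i)"
  let ?H = "\<lambda>n A. {z \<in> space (?P n). \<forall>i<n. norm (gs z i) \<in> A i}"
  have H_sets: "?H m B \<in> sets (?P m)" if "\<And>i. i < m \<Longrightarrow> B i \<in> sets borel" for m B
  proof -
    have "?H m B = {z \<in> space (?P m). \<forall>i\<in>{..<m}. norm (gs z i) \<in> B i}" by auto
    also have "\<dots> \<in> sets (?P m)"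
    proof (rule sets.sets_Collect_finite_All)
      fix i assume i: "i \<in> {..<m}"
      then have "(\<lambda>z. norm (gs z i)) -` B i \<inter> space (?P m) \<in> sets (?P m)"
        by (intro measurable_sets[OF measurable_norm_gs_PiM] that) auto
      moreover have "(\<lambda>z. norm (gs z i)) -` B i \<inter> space (?P m) = {z \<in> space (?P m). norm (gs z i) \<in> B i}"
        by auto
      ultimately show "{z \<in> space (?P m). norm (gs z i) \<in> B i} \<in> sets (?P m)" by simp
    qed simp
    finally show ?thesis .
  qed
  \<comment> \<open>The induction hypothesis itself, at the sets \<open>- {0}\<close>, shows that
    almost surely no earlier residual vanishes; each degree of freedom \<open>DIM('a) - i\<close> is
    positive here.\<close>
  have "emeasure (?P n) {z \<in> space (?P n). \<forall>i<n. norm (gs z i) \<in> - {0}} = (\<Prod>i<n. emeasure (?\<chi> i) (- {0}))"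
    using Suc.prems(1) by (intro Suc.IH) auto
  also have "\<dots> = 1"
    using Suc.prems(1) by (intro prod.neutral) (auto intro: emeasure_chi_distribution_nonzero)
  finally have "AE z in ?P n. \<forall>i<n. norm (gs z i) \<in> - {0}"
    by (rule P.AE_I_eq_1) (rule H_sets[of n "\<lambda>_. - {0}"], simp)
  then have nz: "AE z in ?P n. \<forall>i<n. gs z i \<noteq> 0" by (simp only: norm_eq_zero Compl_iff singleton_iff)
  have ins: "{..<Suc n} = insert n {..<n}" by auto
  have H_upd: "z(n := x) \<in> ?H (Suc n) A \<longleftrightarrow> z \<in> ?H n A \<and> norm (gs (z(n := x)) n) \<in> A n"
    if "z \<in> space (?P n)" for z x
  proof -
    have "gs (z(n := x)) i = gs z i" if "i < n" for i using that by (intro gs_cong) auto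
    moreover have "z(n := x) \<in> space (?P (Suc n))"
      using that by (auto simp: space_PiM PiE_iff extensional_def)
    ultimately show ?thesis using that by (auto simp: less_Suc_eq)
  qed
  have inner: "(\<integral>\<^sup>+x. indicator (?H (Suc n) A) (z(n := x)) \<partial>gauss) = indicator (?H n A) z * emeasure (?\<chi> n) (A n)"
    if z: "z \<in> space (?P n)" "\<forall>i<n. gs z i \<noteq> 0" for z
  proof -
    have [measurable]: "(\<lambda>x. norm (gs (z(n := x)) n)) \<in> borel_measurable borel"
      by (rule measurable_norm_gs_upd)
    have [measurable]: "A n \<in> sets borel" using Suc.prems(2) by simp
    have "(\<integral>\<^sup>+x. indicator (?H (Suc n) A) (z(n := x)) \<partial>gauss)
        = (\<integral>\<^sup>+x. indicator (?H n A) z * indicator (A n) (norm (gs (z(n := x)) n)) \<partial>gauss)"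
      using H_upd[OF z(1)] by (intro nn_integral_cong) (simp add: indicator_def)
    also have "\<dots> = indicator (?H n A) z * (\<integral>\<^sup>+x. indicator (A n) (norm (gs (z(n := x)) n)) \<partial>gauss)"
      by (intro nn_integral_cmult) measurable
    also have "(\<integral>\<^sup>+x. indicator (A n) (norm (gs (z(n := x)) n)) \<partial>gauss)
        = (\<integral>\<^sup>+y. indicator (A n) y \<partial>distr gauss borel (\<lambda>x. norm (gs (z(n := x)) n)))"
      by (subst nn_integral_distr) auto
    also have "\<dots> = emeasure (?\<chi> n) (A n)"
      using Suc.prems(1) z(2) by (subst distr_norm_gs_gauss) auto
    finally show ?thesis .
  qed
  have meas: "?H (Suc n) A \<in> sets (?P (Suc n))" "?H n A \<in> sets (?P n)"
    using Suc.prems(2) by (intro H_sets; simp)+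
  have "emeasure (?P (Suc n)) (?H (Suc n) A) = (\<integral>\<^sup>+z. indicator (?H (Suc n) A) z \<partial>?P (Suc n))"
    by (rule nn_integral_indicator[OF meas(1), symmetric])
  also have "\<dots> = (\<integral>\<^sup>+z. (\<integral>\<^sup>+x. indicator (?H (Suc n) A) (z(n := x)) \<partial>gauss) \<partial>?P n)"
    unfolding ins
    by (rule product_nn_integral_insert[OF _ _ borel_measurable_indicator[OF meas(1)[unfolded ins]]]) simp_all
  also have "\<dots> = (\<integral>\<^sup>+z. indicator (?H n A) z * emeasure (?\<chi> n) (A n) \<partial>?P n)"
  proof (rule nn_integral_cong_AE)
    show "AE z in ?P n. (\<integral>\<^sup>+x. indicator (?H (Suc n) A) (z(n := x)) \<partial>gauss) =
        indicator (?H n A) z * emeasure (?\<chi> n) (A n)"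
      using nz AE_space by eventually_elim (rule inner)
  qed
  also have "\<dots> = emeasure (?P n) (?H n A) * emeasure (?\<chi> n) (A n)"
    by (subst nn_integral_multc[OF borel_measurable_indicator[OF meas(2)]])
      (simp only: nn_integral_indicator[OF meas(2)])
  also have "emeasure (?P n) (?H n A) = (\<Prod>i<n. emeasure (?\<chi> i) (A i))"
    using Suc.prems by (intro Suc.IH) auto
  finally show ?case by simp
qed

lemma distr_norm_gs:
  assumes n: "n \<le> DIM('a)"
  shows "distr (Pi\<^sub>M {..<n} (\<lambda>_. gauss :: 'a::euclidean_space measure)) (Pi\<^sub>M {..<n} (\<lambda>_. borel))
      (\<lambda>z. \<lambda>i\<in>{..<n}. norm (gs z i)) = Pi\<^sub>M {..<n} (\<lambda>i. chi_distribution (DIM('a) - i))"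
proof -
  interpret product_sigma_finite "\<lambda>i. chi_distribution (DIM('a) - i)"
    by (intro product_sigma_finite.intro prob_space_imp_sigma_finite prob_space_chi_distribution)
  let ?P = "Pi\<^sub>M {..<n} (\<lambda>_. gauss :: 'a measure)"
  have meas: "(\<lambda>z. \<lambda>i\<in>{..<n}. norm (gs z i)) \<in> ?P \<rightarrow>\<^sub>M Pi\<^sub>M {..<n} (\<lambda>_. borel)"
    by (intro measurable_restrict measurable_norm_gs_PiM) auto
  show ?thesis
  proof (rule PiM_eqI)
    fix A assume A: "\<And>i. i \<in> {..<n} \<Longrightarrow> A i \<in> sets (chi_distribution (DIM('a) - i))"
    have "(\<lambda>z. \<lambda>i\<in>{..<n}. norm (gs z i)) -` Pi\<^sub>E {..<n} A \<inter> space ?P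
        = {z \<in> space ?P. \<forall>i<n. norm (gs z i) \<in> A i}"
      by (rule set_eqI) (simp add: PiE_iff, blast)
    moreover have "Pi\<^sub>E {..<n} A \<in> sets (Pi\<^sub>M {..<n} (\<lambda>_. borel))"
      using A by (intro sets_PiM_I_finite) auto
    ultimately show "emeasure (distr ?P (Pi\<^sub>M {..<n} (\<lambda>_. borel)) (\<lambda>z. \<lambda>i\<in>{..<n}. norm (gs z i))) (Pi\<^sub>E {..<n} A)
        = (\<Prod>i\<in>{..<n}. emeasure (chi_distribution (DIM('a) - i)) (A i))"
      using emeasure_norm_gs_gauss[OF n, of A] A by (simp only: emeasure_distr[OF meas]) simp
  qed (auto intro!: sets_PiM_cong)
qed

subsection \<open>Decorrelating the edge vectors\<close>

text \<open>The rotation mixes two whole vectors and preserves the inner product of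
  \<open>'a \<times> 'a\<close>. The integral form is the one that occurs inside an iterated
  integral.\<close>

lemma nn_integral_gauss_rotation:
  fixes f :: "'a::euclidean_space \<times> 'a \<Rightarrow> ennreal"
  assumes f[measurable]: "f \<in> borel_measurable borel" and cs: "c\<^sup>2 + s\<^sup>2 = 1"
  shows "(\<integral>\<^sup>+w. f (c *\<^sub>R fst w - s *\<^sub>R snd w, s *\<^sub>R fst w + c *\<^sub>R snd w) \<partial>gauss) = (\<integral>\<^sup>+w. f w \<partial>gauss)"
proof -
  let ?T = "\<lambda>w :: 'a \<times> 'a. (c *\<^sub>R fst w - s *\<^sub>R snd w, s *\<^sub>R fst w + c *\<^sub>R snd w)"
  have "linear ?T"
    by (rule linearI) (simp_all add: algebra_simps)
  moreover have "?T v \<bullet> ?T w = v \<bullet> w" for v w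
  proof -
    have "?T v \<bullet> ?T w = (c\<^sup>2 + s\<^sup>2) * (fst v \<bullet> fst w) + (c\<^sup>2 + s\<^sup>2) * (snd v \<bullet> snd w)"
      by (simp add: inner_prod_def algebra_simps power2_eq_square)
    then show ?thesis by (simp add: cs inner_prod_def)
  qed
  ultimately have T: "orthogonal_transformation ?T" by (simp add: orthogonal_transformation_def)
  note borel_measurable_orthogonal_transformation[OF T]
  then have [measurable]: "?T \<in> borel_measurable gauss" by (simp add: measurable_cong_sets[OF sets_gauss refl])
  have "(\<integral>\<^sup>+w. f w \<partial>gauss) = (\<integral>\<^sup>+w. f w \<partial>distr gauss borel ?T)"
    by (simp add: distr_gauss_orthogonal[OF T])
  also have "\<dots> = (\<integral>\<^sup>+w. f (?T w) \<partial>gauss)"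
    by (rule nn_integral_distr) (use f in simp_all)
  finally show ?thesis by simp
qed

definition plane_rotation :: "'i \<Rightarrow> 'i \<Rightarrow> real \<Rightarrow> real \<Rightarrow> ('i \<Rightarrow> 'a::real_vector) \<Rightarrow> 'i \<Rightarrow> 'a" where
  "plane_rotation a b c s x = x(a := s *\<^sub>R x b + c *\<^sub>R x a, b := c *\<^sub>R x b - s *\<^sub>R x a)"

lemma measurable_plane_rotation:
  assumes ab: "a \<in> I" "b \<in> I"
  shows "plane_rotation a b c s \<in> Pi\<^sub>M I (\<lambda>_. gauss :: 'a::euclidean_space measure) \<rightarrow>\<^sub>M Pi\<^sub>M I (\<lambda>_. gauss)"
proof (rule measurable_PiM_single')
  fix i assume i: "i \<in> I"
  have comp: "(\<lambda>x. x j) \<in> borel_measurable (Pi\<^sub>M I (\<lambda>_. gauss :: 'a measure))" if "j \<in> I" for j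
    using measurable_component_singleton[OF that, of "\<lambda>_. gauss :: 'a measure"]
    by (simp add: measurable_cong_sets[OF refl sets_gauss])
  note [measurable] = comp[OF ab(1)] comp[OF ab(2)] comp[OF i]
  have "(\<lambda>x. plane_rotation a b c s x i) \<in> borel_measurable (Pi\<^sub>M I (\<lambda>_. gauss :: 'a measure))"
    unfolding plane_rotation_def by (cases "i = b"; cases "i = a") simp_all
  then show "(\<lambda>x. plane_rotation a b c s x i) \<in> Pi\<^sub>M I (\<lambda>_. gauss :: 'a measure) \<rightarrow>\<^sub>M gauss"
    by (simp add: measurable_cong_sets[OF refl sets_gauss])
next
  show "plane_rotation a b c s \<in> space (Pi\<^sub>M I (\<lambda>_. gauss)) \<rightarrow> (\<Pi>\<^sub>E i\<in>I. space gauss)"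
    using ab by (auto simp: plane_rotation_def space_PiM PiE_iff extensional_def)
qed

text \<open>With all other entries fixed, entries \<open>a\<close> and \<open>b\<close> form one
  Gaussian vector of \<open>'a \<times> 'a\<close>, and rotating it leaves the inner integral
  unchanged.\<close>

lemma distr_plane_rotation:
  assumes I: "finite I" and ab: "a \<in> I" "b \<in> I" "a \<noteq> b" and cs: "c\<^sup>2 + s\<^sup>2 = 1"
  shows "distr (Pi\<^sub>M I (\<lambda>_. gauss :: 'a::euclidean_space measure)) (Pi\<^sub>M I (\<lambda>_. gauss)) (plane_rotation a b c s)
    = Pi\<^sub>M I (\<lambda>_. gauss)"
proof -
  have sf: "sigma_finite_measure (gauss :: 'a measure)"
    by (rule prob_space_imp_sigma_finite[OF prob_space_gauss])
  interpret product_sigma_finite "\<lambda>_. gauss :: 'a measure"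
    by (intro product_sigma_finite.intro sf)
  let ?P = "Pi\<^sub>M I (\<lambda>_. gauss :: 'a measure)"
  define J where "J = I - {a, b}"
  have J: "finite J" "a \<notin> J" "b \<notin> J" "a \<notin> insert b J" and I_eq: "I = insert a (insert b J)"
    using I ab by (auto simp: J_def)
  \<comment> \<open>Entry \<open>b\<close> is put first so that \<open>plane_rotation\<close> has
    the signs of \<open>nn_integral_gauss_rotation\<close>.\<close>
  have upd: "(\<lambda>w. y(b := fst w, a := snd w)) \<in> (gauss \<Otimes>\<^sub>M gauss) \<rightarrow>\<^sub>M ?P"
    if y: "y \<in> space (Pi\<^sub>M J (\<lambda>_. gauss :: 'a measure))" for y
  proof (rule measurable_PiM_single')
    show "(\<lambda>w. (y(b := fst w, a := snd w)) i) \<in> (gauss :: 'a measure) \<Otimes>\<^sub>M gauss \<rightarrow>\<^sub>M gauss" for i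
      by (cases "i = a"; cases "i = b") simp_all
    show "(\<lambda>w. y(b := fst w, a := snd w)) \<in> space ((gauss :: 'a measure) \<Otimes>\<^sub>M gauss) \<rightarrow> (\<Pi>\<^sub>E i\<in>I. space gauss)"
      using y by (auto simp: space_PiM PiE_iff extensional_def I_eq)
  qed
  have split: "(\<integral>\<^sup>+x. f x \<partial>?P) = (\<integral>\<^sup>+y. (\<integral>\<^sup>+w. f (y(b := fst w, a := snd w)) \<partial>gauss) \<partial>Pi\<^sub>M J (\<lambda>_. gauss))"
    if f: "f \<in> borel_measurable ?P" for f
  proof -
    have f': "f \<in> borel_measurable (Pi\<^sub>M (insert a (insert b J)) (\<lambda>_. gauss))" using f by (simp add: I_eq)
    have "(\<integral>\<^sup>+x. f x \<partial>?P) = (\<integral>\<^sup>+x. (\<integral>\<^sup>+v. f (x(a := v)) \<partial>gauss) \<partial>Pi\<^sub>M (insert b J) (\<lambda>_. gauss))"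
      unfolding I_eq by (rule product_nn_integral_insert[OF _ _ f']) (use J in auto)
    also have "\<dots> = (\<integral>\<^sup>+y. (\<integral>\<^sup>+u. (\<integral>\<^sup>+v. f (y(b := u, a := v)) \<partial>gauss) \<partial>gauss) \<partial>Pi\<^sub>M J (\<lambda>_. gauss))"
    proof (rule product_nn_integral_insert)
      have "(\<lambda>(x, v). f (x(a := v))) \<in> borel_measurable (Pi\<^sub>M (insert b J) (\<lambda>_. gauss) \<Otimes>\<^sub>M gauss)"
        using measurable_comp[OF measurable_add_dim f'] by (simp add: comp_def case_prod_unfold)
      then show "(\<lambda>x. \<integral>\<^sup>+v. f (x(a := v)) \<partial>gauss) \<in> borel_measurable (Pi\<^sub>M (insert b J) (\<lambda>_. gauss))"
        by (rule sigma_finite_measure.borel_measurable_nn_integral[OF sf])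
    qed (use J in auto)
    also have "\<dots> = (\<integral>\<^sup>+y. (\<integral>\<^sup>+w. f (y(b := fst w, a := snd w)) \<partial>gauss) \<partial>Pi\<^sub>M J (\<lambda>_. gauss))"
    proof (rule nn_integral_cong)
      fix y assume y: "y \<in> space (Pi\<^sub>M J (\<lambda>_. gauss :: 'a measure))"
      have "(\<lambda>w. f (y(b := fst w, a := snd w))) \<in> borel_measurable (gauss \<Otimes>\<^sub>M gauss)"
        by (rule measurable_compose[OF upd[OF y] f])
      from sigma_finite_measure.nn_integral_fst[OF sf this]
      show "(\<integral>\<^sup>+u. (\<integral>\<^sup>+v. f (y(b := u, a := v)) \<partial>gauss) \<partial>gauss) = (\<integral>\<^sup>+w. f (y(b := fst w, a := snd w)) \<partial>gauss)"
        by (simp add: gauss_pair)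
    qed
    finally show ?thesis .
  qed
  show ?thesis
  proof (rule measure_eqI)
    fix A assume "A \<in> sets (distr ?P ?P (plane_rotation a b c s))"
    then have A: "A \<in> sets ?P" by simp
    have f: "(indicator A :: _ \<Rightarrow> ennreal) \<in> borel_measurable ?P"
      by (rule borel_measurable_indicator[OF A])
    note R = measurable_plane_rotation[OF ab(1,2), where c = c and s = s]
    have "emeasure (distr ?P ?P (plane_rotation a b c s)) A = (\<integral>\<^sup>+x. indicator A x \<partial>distr ?P ?P (plane_rotation a b c s))"
      by (rule nn_integral_indicator[symmetric]) (use A in simp)
    also have "\<dots> = (\<integral>\<^sup>+x. indicator A (plane_rotation a b c s x) \<partial>?P)"
      by (rule nn_integral_distr[OF R]) (simp only: measurable_distr_eq1 f)
    also have "\<dots> = (\<integral>\<^sup>+y. (\<integral>\<^sup>+w. indicator A (plane_rotation a b c s (y(b := fst w, a := snd w))) \<partial>gauss) \<partial>Pi\<^sub>M J (\<lambda>_. gauss))"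
      by (rule split) (rule measurable_compose[OF R f])
    also have "\<dots> = (\<integral>\<^sup>+y. (\<integral>\<^sup>+w. indicator A (y(b := fst w, a := snd w)) \<partial>gauss) \<partial>Pi\<^sub>M J (\<lambda>_. gauss))"
    proof (rule nn_integral_cong)
      fix y assume y: "y \<in> space (Pi\<^sub>M J (\<lambda>_. gauss :: 'a measure))"
      have "(\<lambda>w. indicator A (y(b := fst w, a := snd w)) :: ennreal) \<in> borel_measurable (gauss \<Otimes>\<^sub>M gauss)"
        by (rule measurable_compose[OF upd[OF y] f])
      then have "(\<lambda>w. indicator A (y(b := fst w, a := snd w)) :: ennreal) \<in> borel_measurable borel"
        unfolding gauss_pair measurable_cong_sets[OF sets_gauss refl] .
      from nn_integral_gauss_rotation[OF this cs]
      show "(\<integral>\<^sup>+w. indicator A (plane_rotation a b c s (y(b := fst w, a := snd w))) \<partial>gauss) =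
          (\<integral>\<^sup>+w. indicator A (y(b := fst w, a := snd w)) \<partial>gauss)"
        using ab(3) by (simp add: plane_rotation_def fun_upd_twist)
    qed
    also have "\<dots> = (\<integral>\<^sup>+x. indicator A x \<partial>?P)" by (rule split[symmetric]) (rule f)
    also have "\<dots> = emeasure ?P A" by (rule nn_integral_indicator[OF A])
    finally show "emeasure (distr ?P ?P (plane_rotation a b c s)) A = emeasure ?P A" .
  qed simp
qed

section \<open>From Gaussian random vectors to the measure \<open>gauss\<close>\<close>

lemma distr_std_gaussian_vector:
  fixes X :: "'w \<Rightarrow> real ^ 'd"
  assumes "prob_space M" and X: "std_gaussian_vector M X"
  shows "distr M borel X = gauss"
proof -
  interpret prob_space M by fact
  have ind: "indep_vars (\<lambda>_. borel) (\<lambda>j \<omega>. X \<omega> $ j) (UNIV :: 'd set)"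
    and dist: "distributed M lborel (\<lambda>\<omega>. X \<omega> $ j) std_normal_density" for j
    using X by (auto simp: std_gaussian_vector_def)
  have meas: "(\<lambda>\<omega>. X \<omega> $ j) \<in> borel_measurable M" for j
    using distributed_measurable[OF dist[of j]] by simp
  have "distr M borel (\<lambda>\<omega>. X \<omega> $ j) = std_normal" for j
    using distributed_distr_eq_density[OF dist[of j]] by (simp cong: distr_cong)
  then have joint: "distr M (Pi\<^sub>M UNIV (\<lambda>_. borel)) (\<lambda>\<omega>. \<lambda>j\<in>UNIV. X \<omega> $ j) = Pi\<^sub>M UNIV (\<lambda>_::'d. std_normal)"
    using ind meas by (subst (asm) indep_vars_iff_distr_eq_PiM) auto
  let ?e = "\<lambda>j. axis j 1 :: real ^ 'd"
  have X_eq: "(\<Sum>j\<in>UNIV. X \<omega> $ j *\<^sub>R ?e j) = X \<omega>" for \<omega>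
    using basis_expansion[of "X \<omega>"] by (simp add: scalar_mult_eq_scaleR)
  have "distr M borel X = distr (distr M (Pi\<^sub>M UNIV (\<lambda>_. borel)) (\<lambda>\<omega>. \<lambda>j\<in>UNIV. X \<omega> $ j)) borel
      (\<lambda>t. \<Sum>j\<in>UNIV. t j *\<^sub>R ?e j)"
  proof (subst distr_distr)
    show "(\<lambda>t. \<Sum>j\<in>UNIV. t j *\<^sub>R ?e j) \<in> borel_measurable (Pi\<^sub>M UNIV (\<lambda>_. borel))"
      by (rule measurable_sum_coordinates) simp
    show "(\<lambda>\<omega>. \<lambda>j\<in>UNIV. X \<omega> $ j) \<in> M \<rightarrow>\<^sub>M Pi\<^sub>M UNIV (\<lambda>_. borel)"
      by (intro measurable_restrict meas)
  qed (simp add: comp_def X_eq)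
  also have "\<dots> = gauss"
    unfolding joint by (rule distr_std_normal_coordinates) (auto simp: inner_axis_axis)
  finally show ?thesis .
qed

text \<open>Its reciprocal is the least coordinate variance of an affine combination of the
  independent points \<open>\<sigma> j X j\<close>, \<open>j \<le> n\<close>.\<close>

definition inv_sq_sum :: "(nat \<Rightarrow> real) \<Rightarrow> nat \<Rightarrow> real" where
  "inv_sq_sum \<sigma> n = (\<Sum>j\<le>n. 1 / (\<sigma> j)\<^sup>2)"

text \<open>The squares of the coefficients sum to 1, so this is again standard Gaussian. The
  weighted mean of the points \<open>\<sigma> j x j\<close> with weights
  \<open>1 / (\<sigma> j)^2\<close> is this vector divided by
  \<open>sqrt (inv_sq_sum \<sigma> n)\<close>.\<close>

definition barycenter :: "(nat \<Rightarrow> real) \<Rightarrow> nat \<Rightarrow> (nat \<Rightarrow> 'a::real_vector) \<Rightarrow> 'a" where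
  "barycenter \<sigma> n x = (1 / sqrt (inv_sq_sum \<sigma> n)) *\<^sub>R (\<Sum>j\<le>n. (1 / \<sigma> j) *\<^sub>R x j)"

text \<open>Entry \<open>0\<close> is the normalized running sum, and entry \<open>k + 1\<close> is the vector \<open>Z k\<close>.\<close>

primrec decorrelate :: "(nat \<Rightarrow> real) \<Rightarrow> nat \<Rightarrow> (nat \<Rightarrow> 'a::real_vector) \<Rightarrow> nat \<Rightarrow> 'a" where
  "decorrelate \<sigma> 0 x = x"
| "decorrelate \<sigma> (Suc n) x = plane_rotation 0 (Suc n) (sqrt (inv_sq_sum \<sigma> n / inv_sq_sum \<sigma> (Suc n)))
     (1 / (\<sigma> (Suc n) * sqrt (inv_sq_sum \<sigma> (Suc n)))) (decorrelate \<sigma> n x)"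

lemma inv_sq_sum_pos:
  assumes "\<And>i. i \<le> n \<Longrightarrow> \<sigma> i > 0"
  shows "inv_sq_sum \<sigma> n > 0"
  unfolding inv_sq_sum_def using assms by (intro sum_pos) fastforce+

lemma inv_sq_sum_Suc: "inv_sq_sum \<sigma> (Suc n) = inv_sq_sum \<sigma> n + 1 / (\<sigma> (Suc n))\<^sup>2"
  by (simp add: inv_sq_sum_def)

text \<open>The coefficients are the sine and cosine used in \<open>decorrelate\<close> at
  \<open>Suc n\<close>, which is why entry 0 remains the normalized sum.\<close>

lemma barycenter_Suc:
  assumes "\<And>i. i \<le> Suc n \<Longrightarrow> \<sigma> i > 0"
  shows "barycenter \<sigma> (Suc n) x = (1 / (\<sigma> (Suc n) * sqrt (inv_sq_sum \<sigma> (Suc n)))) *\<^sub>R x (Suc n) +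
    sqrt (inv_sq_sum \<sigma> n / inv_sq_sum \<sigma> (Suc n)) *\<^sub>R barycenter \<sigma> n x"
proof -
  have "inv_sq_sum \<sigma> n > 0" using assms by (intro inv_sq_sum_pos) auto
  then show ?thesis
    by (simp add: barycenter_def scaleR_add_right real_sqrt_divide mult.commute)
qed

text \<open>Each rotation reads entry 0 and a still untouched entry, so the three claims are proved
  together. Entry \<open>Suc k\<close> is final once written: later rotations change only entry 0
  and larger indices.\<close>

lemma decorrelate_apply:
  assumes "\<And>i. i \<le> n \<Longrightarrow> \<sigma> i > 0"
  shows "decorrelate \<sigma> n x 0 = barycenter \<sigma> n x"
    and "n < i \<Longrightarrow> decorrelate \<sigma> n x i = x i"
    and "k < n \<Longrightarrow> decorrelate \<sigma> n x (Suc k) = sqrt (inv_sq_sum \<sigma> k / inv_sq_sum \<sigma> (Suc k)) *\<^sub>R x (Suc k) -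
      (1 / (\<sigma> (Suc k) * sqrt (inv_sq_sum \<sigma> (Suc k)))) *\<^sub>R barycenter \<sigma> k x"
proof -
  have "decorrelate \<sigma> n x 0 = barycenter \<sigma> n x \<and> (\<forall>i>n. decorrelate \<sigma> n x i = x i) \<and>
    (\<forall>k<n. decorrelate \<sigma> n x (Suc k) = sqrt (inv_sq_sum \<sigma> k / inv_sq_sum \<sigma> (Suc k)) *\<^sub>R x (Suc k) -
      (1 / (\<sigma> (Suc k) * sqrt (inv_sq_sum \<sigma> (Suc k)))) *\<^sub>R barycenter \<sigma> k x)"
    using assms
  proof (induction n)
    case 0
    then have "sqrt (1 / (\<sigma> 0)\<^sup>2) = 1 / \<sigma> 0" by (simp add: real_sqrt_divide less_imp_le)
    moreover have "\<sigma> 0 > 0" using 0 by simp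
    ultimately show ?case by (simp add: barycenter_def inv_sq_sum_def)
  next
    case (Suc n)
    then have IH: "decorrelate \<sigma> n x 0 = barycenter \<sigma> n x" "\<And>i. i > n \<Longrightarrow> decorrelate \<sigma> n x i = x i"
      "\<And>k. k < n \<Longrightarrow> decorrelate \<sigma> n x (Suc k) = sqrt (inv_sq_sum \<sigma> k / inv_sq_sum \<sigma> (Suc k)) *\<^sub>R x (Suc k) -
        (1 / (\<sigma> (Suc k) * sqrt (inv_sq_sum \<sigma> (Suc k)))) *\<^sub>R barycenter \<sigma> k x"
      by simp_all
    have "decorrelate \<sigma> (Suc n) x 0 = barycenter \<sigma> (Suc n) x"
      using barycenter_Suc[OF Suc.prems, where x = x] by (simp add: plane_rotation_def IH)
    then show ?case
      using IH by (auto simp: plane_rotation_def less_Suc_eq)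
  qed
  then show "decorrelate \<sigma> n x 0 = barycenter \<sigma> n x"
    and "n < i \<Longrightarrow> decorrelate \<sigma> n x i = x i"
    and "k < n \<Longrightarrow> decorrelate \<sigma> n x (Suc k) = sqrt (inv_sq_sum \<sigma> k / inv_sq_sum \<sigma> (Suc k)) *\<^sub>R x (Suc k) -
      (1 / (\<sigma> (Suc k) * sqrt (inv_sq_sum \<sigma> (Suc k)))) *\<^sub>R barycenter \<sigma> k x"
    by auto
qed

lemma distr_decorrelate:
  assumes "n \<le> l" and \<sigma>: "\<And>i. i \<le> n \<Longrightarrow> \<sigma> i > 0"
  shows "decorrelate \<sigma> n \<in> Pi\<^sub>M {0..l} (\<lambda>_. gauss :: 'a::euclidean_space measure) \<rightarrow>\<^sub>M Pi\<^sub>M {0..l} (\<lambda>_. gauss)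
    \<and> distr (Pi\<^sub>M {0..l} (\<lambda>_. gauss :: 'a measure)) (Pi\<^sub>M {0..l} (\<lambda>_. gauss)) (decorrelate \<sigma> n)
      = Pi\<^sub>M {0..l} (\<lambda>_. gauss)"
  using assms
proof (induction n)
  case 0
  have "decorrelate \<sigma> 0 = (\<lambda>x :: nat \<Rightarrow> 'a. x)" by (rule ext) simp
  then show ?case by (simp add: distr_id2)
next
  case (Suc n)
  let ?P = "Pi\<^sub>M {0..l} (\<lambda>_. gauss :: 'a measure)"
  let ?c = "sqrt (inv_sq_sum \<sigma> n / inv_sq_sum \<sigma> (Suc n))"
  let ?s = "1 / (\<sigma> (Suc n) * sqrt (inv_sq_sum \<sigma> (Suc n)))"
  have pos: "inv_sq_sum \<sigma> n > 0" "inv_sq_sum \<sigma> (Suc n) > 0" "\<sigma> (Suc n) > 0"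
    using Suc.prems by (auto intro!: inv_sq_sum_pos)
  \<comment> \<open>The recursion of \<open>inv_sq_sum\<close> is exactly the Pythagorean identity
    for the two coefficients.\<close>
  have "?c\<^sup>2 + ?s\<^sup>2 = (inv_sq_sum \<sigma> n + 1 / (\<sigma> (Suc n))\<^sup>2) / inv_sq_sum \<sigma> (Suc n)"
    using pos by (simp add: power_mult_distrib power_divide add_divide_distrib)
  also have "\<dots> = 1" using pos(2) by (simp add: inv_sq_sum_Suc)
  finally have cs: "?c\<^sup>2 + ?s\<^sup>2 = 1" .
  have IH: "decorrelate \<sigma> n \<in> ?P \<rightarrow>\<^sub>M ?P" "distr ?P ?P (decorrelate \<sigma> n) = ?P"
    using Suc by auto
  have R: "plane_rotation 0 (Suc n) ?c ?s \<in> ?P \<rightarrow>\<^sub>M ?P"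
    using Suc.prems by (intro measurable_plane_rotation) auto
  have eq: "decorrelate \<sigma> (Suc n) = plane_rotation 0 (Suc n) ?c ?s \<circ> (decorrelate \<sigma> n :: (nat \<Rightarrow> 'a) \<Rightarrow> _)"
    by (rule ext) simp
  have "distr ?P ?P (decorrelate \<sigma> (Suc n)) = distr (distr ?P ?P (decorrelate \<sigma> n)) ?P (plane_rotation 0 (Suc n) ?c ?s)"
    unfolding eq by (rule distr_distr[OF R IH(1), symmetric])
  also have "\<dots> = ?P"
    unfolding IH(2) using Suc.prems by (intro distr_plane_rotation cs) auto
  finally show ?case
    unfolding eq by (rule conjI[OF measurable_comp[OF IH(1) R]])
qed

text \<open>The distance from \<open>\<sigma> (k+1) x (k+1)\<close> to the affine hull of its predecessors is measured from
  any point of that hull; with the weights \<open>1 / (\<sigma> j)\<^sup>2\<close> this is the barycenter, and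
  the difference is a multiple of the decorrelated vector.\<close>

lemma decorrelate_residual:
  fixes x :: "nat \<Rightarrow> 'a::real_vector"
  assumes \<sigma>: "\<And>i. i \<le> l \<Longrightarrow> \<sigma> i > 0" and k: "k < l"
  defines "v \<equiv> \<lambda>k. \<sigma> (Suc k) *\<^sub>R x (Suc k) - \<sigma> 0 *\<^sub>R x 0"
  shows "v k - (\<sigma> (Suc k) * sqrt (inv_sq_sum \<sigma> (Suc k) / inv_sq_sum \<sigma> k)) *\<^sub>R decorrelate \<sigma> l x (Suc k)
    \<in> span (v ` {..<k})"
proof -
  let ?s = "inv_sq_sum \<sigma> k" and ?s' = "inv_sq_sum \<sigma> (Suc k)"
  have pos: "?s > 0" "?s' > 0" "\<sigma> (Suc k) > 0"
    using \<sigma> k by (auto intro!: inv_sq_sum_pos)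
  have "(\<sigma> (Suc k) * sqrt (?s' / ?s)) *\<^sub>R decorrelate \<sigma> l x (Suc k) =
      (\<sigma> (Suc k) * sqrt (?s' / ?s) * sqrt (?s / ?s')) *\<^sub>R x (Suc k) -
      (\<sigma> (Suc k) * sqrt (?s' / ?s) * (1 / (\<sigma> (Suc k) * sqrt ?s'))) *\<^sub>R barycenter \<sigma> k x"
    using decorrelate_apply(3)[OF \<sigma> k, where x = x] by (simp add: scaleR_diff_right)
  \<comment> \<open>The factor is chosen to make this coefficient equal to the one of
    \<open>x (Suc k)\<close> in \<open>v k\<close>.\<close>
  also have "\<sigma> (Suc k) * sqrt (?s' / ?s) * sqrt (?s / ?s') = \<sigma> (Suc k)"
    using pos by (simp add: real_sqrt_divide)
  also have "\<sigma> (Suc k) * sqrt (?s' / ?s) * (1 / (\<sigma> (Suc k) * sqrt ?s')) = 1 / sqrt ?s"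
    using pos by (simp add: real_sqrt_divide)
  also have "(1 / sqrt ?s) *\<^sub>R barycenter \<sigma> k x = (1 / ?s) *\<^sub>R (\<Sum>j\<le>k. (1 / \<sigma> j) *\<^sub>R x j)"
    using pos by (simp add: barycenter_def)
  finally have 1: "v k - (\<sigma> (Suc k) * sqrt (?s' / ?s)) *\<^sub>R decorrelate \<sigma> l x (Suc k) =
      (1 / ?s) *\<^sub>R (\<Sum>j\<le>k. (1 / \<sigma> j) *\<^sub>R x j) - \<sigma> 0 *\<^sub>R x 0"
    by (simp add: v_def)
  have "(1 / ?s) *\<^sub>R (\<Sum>j\<le>k. (1 / (\<sigma> j)\<^sup>2) *\<^sub>R (\<sigma> j *\<^sub>R x j - \<sigma> 0 *\<^sub>R x 0)) =
      (1 / ?s) *\<^sub>R (\<Sum>j\<le>k. (1 / \<sigma> j) *\<^sub>R x j) - (1 / ?s * ?s) *\<^sub>R \<sigma> 0 *\<^sub>R x 0"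
  proof -
    have "(1 / (\<sigma> j)\<^sup>2) *\<^sub>R (\<sigma> j *\<^sub>R x j - \<sigma> 0 *\<^sub>R x 0) = (1 / \<sigma> j) *\<^sub>R x j - (1 / (\<sigma> j)\<^sup>2) *\<^sub>R \<sigma> 0 *\<^sub>R x 0"
      if "j \<le> k" for j
      using \<sigma>[of j] that k by (simp add: scaleR_diff_right power2_eq_square)
    then have "(\<Sum>j\<le>k. (1 / (\<sigma> j)\<^sup>2) *\<^sub>R (\<sigma> j *\<^sub>R x j - \<sigma> 0 *\<^sub>R x 0)) =
        (\<Sum>j\<le>k. (1 / \<sigma> j) *\<^sub>R x j) - ?s *\<^sub>R \<sigma> 0 *\<^sub>R x 0"
      by (simp add: sum_subtractf inv_sq_sum_def scaleR_sum_left sum_distrib_right)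
    then show ?thesis by (simp only: scaleR_diff_right scaleR_scaleR mult.assoc)
  qed
  \<comment> \<open>The term \<open>j = 0\<close> vanishes; the others are the earlier edges, with
    the index lowered by one.\<close>
  also have "(\<Sum>j\<le>k. (1 / (\<sigma> j)\<^sup>2) *\<^sub>R (\<sigma> j *\<^sub>R x j - \<sigma> 0 *\<^sub>R x 0)) = (\<Sum>j<k. (1 / (\<sigma> (Suc j))\<^sup>2) *\<^sub>R v j)"
    by (simp add: sum.atMost_shift v_def)
  finally have "v k - (\<sigma> (Suc k) * sqrt (?s' / ?s)) *\<^sub>R decorrelate \<sigma> l x (Suc k) =
      (1 / ?s) *\<^sub>R (\<Sum>j<k. (1 / (\<sigma> (Suc j))\<^sup>2) *\<^sub>R v j)"
    using 1 pos by simp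
  also have "\<dots> \<in> span (v ` {..<k})"
    by (intro span_scale span_sum span_base) auto
  finally show ?thesis .
qed

text \<open>The roots telescope to
  \<open>sqrt (inv_sq_sum \<sigma> l / inv_sq_sum \<sigma> 0)\<close>, and
  \<open>1 / sqrt (inv_sq_sum \<sigma> 0) = \<sigma> 0\<close> supplies the factor missing from the
  product of the \<open>\<sigma> (Suc k)\<close>.\<close>

lemma prod_decorrelate_factor:
  assumes "\<And>i. i \<le> l \<Longrightarrow> \<sigma> i > 0"
  shows "(\<Prod>k<l. \<sigma> (Suc k) * sqrt (inv_sq_sum \<sigma> (Suc k) / inv_sq_sum \<sigma> k)) = (\<Prod>i\<le>l. \<sigma> i) * sqrt (inv_sq_sum \<sigma> l)"
  using assms
proof (induction l)
  case 0
  then show ?case by (simp add: inv_sq_sum_def real_sqrt_divide less_imp_le)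
next
  case (Suc l)
  then have "inv_sq_sum \<sigma> l > 0" by (intro inv_sq_sum_pos) auto
  with Suc show ?case by (simp add: real_sqrt_divide)
qed

text \<open>A deterministic identity, degenerate configurations included; randomness enters only
  through the law of the last product.\<close>

lemma volume_dim_scaled_simplex:
  fixes x :: "nat \<Rightarrow> 'a::euclidean_space"
  assumes l: "l \<le> DIM('a)" and \<sigma>: "\<And>i. i \<le> l \<Longrightarrow> \<sigma> i > 0"
  shows "volume_dim l (convex hull ((\<lambda>i. \<sigma> i *\<^sub>R x i) ` {0..l})) =
    1 / fact l * (\<Prod>i=0..l. \<sigma> i) * sqrt (\<Sum>i=0..l. 1 / (\<sigma> i)\<^sup>2) *
      (\<Prod>k<l. norm (gs (\<lambda>k. decorrelate \<sigma> l x (Suc k)) k))"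
proof -
  let ?v = "\<lambda>k. \<sigma> (Suc k) *\<^sub>R x (Suc k) - \<sigma> 0 *\<^sub>R x 0"
  let ?z = "\<lambda>k. decorrelate \<sigma> l x (Suc k)"
  let ?c = "\<lambda>k. \<sigma> (Suc k) * sqrt (inv_sq_sum \<sigma> (Suc k) / inv_sq_sum \<sigma> k)"
  have pos: "?c k > 0" if "k < l" for k
    using \<sigma> that inv_sq_sum_pos[of k \<sigma>] inv_sq_sum_pos[of "Suc k" \<sigma>] by simp
  have "norm (gs ?v k) = ?c k * norm (gs ?z k)" if "k < l" for k
  proof -
    have "gs ?v k = ?c k *\<^sub>R gs ?z k"
    proof (rule gs_triangular)
      show "?c i \<noteq> 0" if "i < l" for i using pos[OF that] by (rule less_imp_neq[THEN not_sym])
      show "?v i - ?c i *\<^sub>R ?z i \<in> span (?v ` {..<i})" if "i < l" for i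
        by (rule decorrelate_residual[OF \<sigma> that])
    qed (rule that)
    then show ?thesis using pos[OF that] by (simp only: norm_scaleR abs_of_pos)
  qed
  then have "(\<Prod>k<l. norm (gs ?v k)) = (\<Prod>k<l. ?c k) * (\<Prod>k<l. norm (gs ?z k))"
    by (simp add: prod.distrib)
  also have "(\<Prod>k<l. ?c k) = (\<Prod>i=0..l. \<sigma> i) * sqrt (\<Sum>i=0..l. 1 / (\<sigma> i)\<^sup>2)"
    unfolding atLeast0AtMost inv_sq_sum_def[symmetric] using \<sigma> by (rule prod_decorrelate_factor)
  finally show ?thesis
    using volume_dim_simplex[OF l, of "\<lambda>i. \<sigma> i *\<^sub>R x i"] by simp
qed

text \<open>Rotation preserves the product law, and discarding entry 0, the normalized sum, leaves
  \<open>l\<close> independent Gaussian vectors.\<close>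

lemma distr_norm_gs_decorrelate:
  assumes l: "l \<le> DIM('a)" and \<sigma>: "\<And>i. i \<le> l \<Longrightarrow> \<sigma> i > 0"
  shows "(\<lambda>x. \<lambda>k\<in>{..<l}. norm (gs (\<lambda>k. decorrelate \<sigma> l x (Suc k)) k))
      \<in> Pi\<^sub>M {0..l} (\<lambda>_. gauss :: 'a::euclidean_space measure) \<rightarrow>\<^sub>M Pi\<^sub>M {..<l} (\<lambda>_. borel)" (is "?F \<in> _")
    and "distr (Pi\<^sub>M {0..l} (\<lambda>_. gauss :: 'a measure)) (Pi\<^sub>M {..<l} (\<lambda>_. borel))
        (\<lambda>x. \<lambda>k\<in>{..<l}. norm (gs (\<lambda>k. decorrelate \<sigma> l x (Suc k)) k))
      = Pi\<^sub>M {..<l} (\<lambda>i. chi_distribution (DIM('a) - i))"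
proof -
  let ?P = "Pi\<^sub>M {0..l} (\<lambda>_. gauss :: 'a measure)"
  let ?Q = "Pi\<^sub>M {..<l} (\<lambda>_. gauss :: 'a measure)"
  let ?shift = "\<lambda>x :: nat \<Rightarrow> 'a. \<lambda>k\<in>{..<l}. x (Suc k)"
  let ?H = "\<lambda>z :: nat \<Rightarrow> 'a. \<lambda>k\<in>{..<l}. norm (gs z k)"
  have S: "?shift \<in> ?P \<rightarrow>\<^sub>M ?Q"
    by (intro measurable_restrict measurable_component_singleton) auto
  have H: "?H \<in> ?Q \<rightarrow>\<^sub>M Pi\<^sub>M {..<l} (\<lambda>_. borel)"
    by (intro measurable_restrict measurable_norm_gs_PiM) auto
  have D: "decorrelate \<sigma> l \<in> ?P \<rightarrow>\<^sub>M ?P" "distr ?P ?P (decorrelate \<sigma> l) = ?P"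
    using distr_decorrelate[where \<sigma> = \<sigma> and n = l and l = l and 'a = 'a] \<sigma> by auto
  have F: "?F = ?H \<circ> (?shift \<circ> decorrelate \<sigma> l)"
    by (auto simp: fun_eq_iff restrict_def intro!: arg_cong[where f = norm] gs_cong)
  show "?F \<in> ?P \<rightarrow>\<^sub>M Pi\<^sub>M {..<l} (\<lambda>_. borel)"
    unfolding F by (intro measurable_comp[OF measurable_comp[OF D(1) S] H])
  have "distr ?P (Pi\<^sub>M {..<l} (\<lambda>_. borel)) ?F = distr (distr (distr ?P ?P (decorrelate \<sigma> l)) ?Q ?shift) (Pi\<^sub>M {..<l} (\<lambda>_. borel)) ?H"
    unfolding F distr_distr[OF S D(1)] by (rule distr_distr[OF H measurable_comp[OF D(1) S], symmetric])
  also note D(2)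
  also have "distr ?P ?Q ?shift = ?Q"
    by (rule distr_PiM_reindex) (auto simp: prob_space_gauss)
  also have "distr ?Q (Pi\<^sub>M {..<l} (\<lambda>_. borel)) ?H = Pi\<^sub>M {..<l} (\<lambda>i. chi_distribution (DIM('a) - i))"
    by (rule distr_norm_gs[OF l])
  finally show "distr ?P (Pi\<^sub>M {..<l} (\<lambda>_. borel)) ?F = Pi\<^sub>M {..<l} (\<lambda>i. chi_distribution (DIM('a) - i))" .
qed

section \<open>Both sides as images of one product of chi laws\<close>

theorem theorem1p1:
  fixes M :: "'w measure" and N :: "'v measure"
    and X :: "nat \<Rightarrow> 'w \<Rightarrow> real ^ 'd"
    and Y :: "nat \<Rightarrow> 'v \<Rightarrow> real"
    and \<sigma> :: "nat \<Rightarrow> real" and l :: nat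
  assumes "prob_space M" and "prob_space N"
    and "l \<in> {1..CARD('d)}"
    and "\<And>i. i \<le> l \<Longrightarrow> std_gaussian_vector M (X i)"
    and "prob_space.indep_vars M (\<lambda>_. borel) X {0..l}"
    and "\<And>i. i \<le> l \<Longrightarrow> \<sigma> i > 0"
    and "prob_space.indep_vars N (\<lambda>_. borel) Y {CARD('d) - l + 1..CARD('d)}"
    and "\<And>k. k \<in> {CARD('d) - l + 1..CARD('d)} \<Longrightarrow> distr N borel (Y k) = chi_distribution k"
  shows "eq_in_distribution
     M (\<lambda>\<omega>. volume_dim l (convex hull ((\<lambda>i. \<sigma> i *\<^sub>R X i \<omega>) ` {0..l})))
     N (\<lambda>\<omega>. 1 / fact l * (\<Prod>i=0..l. \<sigma> i) * sqrt (\<Sum>i=0..l. 1 / (\<sigma> i)\<^sup>2)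
             * (\<Prod>k=CARD('d) - l + 1..CARD('d). Y k \<omega>))"
proof -
  interpret M: prob_space M by fact
  interpret N: prob_space N by fact
  let ?d = "CARD('d)"
  let ?I = "{?d - l + 1..?d}"
  let ?P = "Pi\<^sub>M {0..l} (\<lambda>_. gauss :: (real ^ 'd) measure)"
  let ?B = "Pi\<^sub>M {..<l} (\<lambda>_. borel :: real measure)"
  let ?\<chi> = "Pi\<^sub>M {..<l} (\<lambda>i. chi_distribution (?d - i))"
  let ?C = "1 / fact l * (\<Prod>i=0..l. \<sigma> i) * sqrt (\<Sum>i=0..l. 1 / (\<sigma> i)\<^sup>2)"
  let ?prod = "\<lambda>y. ?C * (\<Prod>k<l. y k)"
  let ?V = "\<lambda>\<omega>. volume_dim l (convex hull ((\<lambda>i. \<sigma> i *\<^sub>R X i \<omega>) ` {0..l}))"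
  let ?W = "\<lambda>\<omega>. ?C * (\<Prod>k\<in>?I. Y k \<omega>)"
  have l: "l \<le> ?d" "l \<ge> 1" and l': "l \<le> DIM(real ^ 'd)" using assms(3) by auto
  have prod: "?prod \<in> borel_measurable ?B"
    by (intro borel_measurable_times borel_measurable_const borel_measurable_prod measurable_component_singleton)

  let ?\<Xi> = "\<lambda>\<omega>. \<lambda>i\<in>{0..l}. X i \<omega>"
  let ?F = "\<lambda>x :: nat \<Rightarrow> real ^ 'd. \<lambda>k\<in>{..<l}. norm (gs (\<lambda>k. decorrelate \<sigma> l x (Suc k)) k)"
  note F = distr_norm_gs_decorrelate[where 'a = "real ^ 'd", OF l' assms(6), simplified DIM_cart DIM_real mult_1_right]
  have X: "X i \<in> borel_measurable M" if "i \<in> {0..l}" for i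
    using assms(5) that by (auto simp: M.indep_vars_def)
  have sets_P: "sets ?P = sets (Pi\<^sub>M {0..l} (\<lambda>_. borel))" by (intro sets_PiM_cong) auto
  have \<Xi>: "?\<Xi> \<in> M \<rightarrow>\<^sub>M ?P"
    unfolding measurable_cong_sets[OF refl sets_P] by (intro measurable_restrict X)
  have "distr M ?P ?\<Xi> = distr M (Pi\<^sub>M {0..l} (\<lambda>_. borel)) ?\<Xi>"
    by (intro distr_cong sets_P refl)
  also have "\<dots> = (\<Pi>\<^sub>M i\<in>{0..l}. distr M borel (X i))"
    using assms(5) by (subst (asm) M.indep_vars_iff_distr_eq_PiM') (auto intro: X)
  also have "\<dots> = ?P"
    using assms(4) by (intro PiM_cong distr_std_gaussian_vector[OF assms(1)]) auto
  finally have distr_\<Xi>: "distr M ?P ?\<Xi> = ?P" .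
  \<comment> \<open>The residuals with \<open>k < l\<close> involve only
    \<open>X 0, ..., X l\<close>, so restricting the family to \<open>{0..l}\<close> changes
    nothing.\<close>
  have V: "?V = ?prod \<circ> (?F \<circ> ?\<Xi>)"
  proof
    fix \<omega>
    have "gs (\<lambda>k. decorrelate \<sigma> l (\<lambda>i. X i \<omega>) (Suc k)) k = gs (\<lambda>k. decorrelate \<sigma> l (?\<Xi> \<omega>) (Suc k)) k"
      if "k < l" for k
      using that by (intro gs_cong) (simp add: decorrelate_apply(3)[OF assms(6)] barycenter_def)
    then show "?V \<omega> = (?prod \<circ> (?F \<circ> ?\<Xi>)) \<omega>"
      by (subst volume_dim_scaled_simplex[OF l' assms(6)]) simp_all
  qed
  have V_meas: "?V \<in> borel_measurable M"
    unfolding V by (intro measurable_comp[OF measurable_comp[OF \<Xi> F(1)] prod])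
  have "distr M borel ?V = distr (distr M ?B (?F \<circ> ?\<Xi>)) borel ?prod"
    unfolding V by (rule distr_distr[OF prod measurable_comp[OF \<Xi> F(1)], symmetric])
  also have "distr M ?B (?F \<circ> ?\<Xi>) = distr (distr M ?P ?\<Xi>) ?B ?F"
    by (rule distr_distr[OF F(1) \<Xi>, symmetric])
  also have "\<dots> = ?\<chi>"
    unfolding distr_\<Xi> by (rule F(2))
  finally have distr_V: "distr M borel ?V = distr ?\<chi> borel ?prod" .

  let ?\<Psi> = "\<lambda>\<omega>. \<lambda>k\<in>?I. Y k \<omega>"
  \<comment> \<open>Height \<open>i\<close> has \<open>d - i\<close> degrees of freedom, so the
    order is reversed: \<open>i = 0\<close> corresponds to \<open>Y d\<close> and
    \<open>i = l - 1\<close> to \<open>Y (d - l + 1)\<close>.\<close>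
  let ?R = "\<lambda>y :: nat \<Rightarrow> real. \<lambda>i\<in>{..<l}. y (?d - i)"
  let ?BI = "Pi\<^sub>M ?I (\<lambda>_. borel :: real measure)"
  have Y: "Y k \<in> borel_measurable N" if "k \<in> ?I" for k
    using assms(7) that by (auto simp: N.indep_vars_def)
  have \<Psi>: "?\<Psi> \<in> N \<rightarrow>\<^sub>M ?BI" by (intro measurable_restrict Y)
  have R: "?R \<in> ?BI \<rightarrow>\<^sub>M ?B"
    using l by (intro measurable_restrict measurable_component_singleton) auto
  \<comment> \<open>The bound \<open>l \<ge> 1\<close> makes the index set nonempty for this
    characterization of independence.\<close>
  have "distr N ?BI ?\<Psi> = (\<Pi>\<^sub>M k\<in>?I. distr N borel (Y k))"
    using assms(7) l by (subst (asm) N.indep_vars_iff_distr_eq_PiM') (auto intro: Y)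
  also have "\<dots> = Pi\<^sub>M ?I chi_distribution"
    using assms(8) by (intro PiM_cong) auto
  finally have distr_\<Psi>: "distr N ?BI ?\<Psi> = Pi\<^sub>M ?I chi_distribution" .
  have bij: "bij_betw (\<lambda>i. ?d - i) {..<l} ?I"
    by (rule bij_betw_byWitness[where f' = "\<lambda>k. ?d - k"]) (use l in auto)
  have W: "?W = ?prod \<circ> (?R \<circ> ?\<Psi>)"
  proof
    fix \<omega>
    have "(\<Prod>k\<in>?I. Y k \<omega>) = (\<Prod>i<l. Y (?d - i) \<omega>)"
      by (rule prod.reindex_bij_betw[OF bij, symmetric])
    also have "\<dots> = (\<Prod>i<l. ?R (?\<Psi> \<omega>) i)"
      using bij_betwE[OF bij] by (intro prod.cong) auto
    finally show "?W \<omega> = (?prod \<circ> (?R \<circ> ?\<Psi>)) \<omega>" by simp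
  qed
  have W_meas: "?W \<in> borel_measurable N"
    unfolding W by (intro measurable_comp[OF measurable_comp[OF \<Psi> R] prod])
  have "distr N borel ?W = distr (distr N ?B (?R \<circ> ?\<Psi>)) borel ?prod"
    unfolding W by (rule distr_distr[OF prod measurable_comp[OF \<Psi> R], symmetric])
  also have "distr N ?B (?R \<circ> ?\<Psi>) = distr (distr N ?BI ?\<Psi>) ?B ?R"
    by (rule distr_distr[OF R \<Psi>, symmetric])
  also have "\<dots> = distr (Pi\<^sub>M ?I chi_distribution) ?\<chi> ?R"
    unfolding distr_\<Psi> by (intro distr_cong refl sets_PiM_cong) auto
  also have "\<dots> = ?\<chi>"
    by (rule distr_PiM_reindex) (use bij in \<open>auto simp: bij_betw_def prob_space_chi_distribution\<close>)
  finally have distr_W: "distr N borel ?W = distr ?\<chi> borel ?prod" .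
  show ?thesis
    unfolding eq_in_distribution_def using V_meas W_meas distr_V distr_W by simp
qed

end
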